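(* Let $h:\Omega\to\mathbb{R}$ and $H:[0,T]\times\Omega\times\mathbb{R}\times\mathbb{R}^d\to\mathbb{R}$ satisfy the standing assumptions listed in the context. Let $L\ge0$, let $u$ be a minimax $L$-subsolution and let $v$ be a minimax $L$-supersolution of the terminal-value problem $$-\partial_t u-H(t,x,u,\partial_x u)=0 \text{ on } [0,T)\times\Omega,\qquad u(T,x)=h(x),\ x\in\Omega.$$ Then $u\le v$ on $[0,T]\times\Omega$.
   Context: Setting. Fix $T>0$ and $d\in\mathbb{N}$. $\Omega=D([0,T],\mathbb{R}^d)$ is the set of all right-continuous functions $x:[0,T]\to\mathbb{R}^d$ that have left limits, equipped with the supremum norm $\|\cdot\|_\infty$. The set $[0,T]\times\Omega$ is equipped with the pseudo-metric $\mathbf{d}_\infty((t,x),(s,\tilde x)):=|t-s|+\sup_{0\le r\le T}|x(r\wedge t)-\tilde x(r\wedge s)|$; upper semicontinuity (USC) and lower semicontinuity (LSC) of real-valued functions on $[0,T]\times\Omega$ are with respect to $\mathbf{d}_\infty$. Standing assumptions on the data. $h$ is continuous on $(\Omega,\|\cdot\|_\infty)$. $H$ is non-anticipating ($x|_{[0,t]}=\tilde x|_{[0,t]}$ implies $H(t,x,y,z)=H(t,\tilde x,y,z)$) and satisfies: (i) for a.e. $t\in(0,T)$, $(x,y,z)\mapsto H(t,x,y,z)$ is continuous; (ii) for every $(x,y,z)$, $t\mapsto H(t,x,y,z)$ is Borel measurable; (iii) there is a constant $L_H\ge0$ such that for a.e. $t\in(0,T)$ and every $x\in\Omega$, $y\in\mathbb{R}$,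 $z,\tilde z\in\mathbb{R}^d$: $|H(t,x,y,z)-H(t,x,y,\tilde z)|\le L_H(1+\sup_{s\le t}|x(s)|)|z-\tilde z|$; (iv) for every $L\ge0$ there is a constant $M_L\ge0$ such that for every $(t_0,x_0)\in[0,T)\times\Omega$, $x,\tilde x\in\mathcal{X}^L(t_0,x_0)$, $y\in\mathbb{R}$, $z\in\mathbb{R}^d$ and a.e. $t\in(t_0,T)$: $|H(t,x,y,z)-H(t,\tilde x,y,z)|\le M_L(1+|y|+|z|)\sup_{s\le t}|x(s)-\tilde x(s)|$; (v) for a.e. $t\in(0,T)$ and every $(x,z)$, $y\mapsto H(t,x,y,z)$ is non-increasing; (vi) there is a constant $C_H\ge0$ such that for a.e. $t\in(0,T)$ and all $(x,y)$: $|H(t,x,y,0)|\le C_H(1+\sup_{s\le t}|x(s)|+|y|)$. Path sets. For $L\ge0$ and $(s_0,x_0)\in[0,T)\times\Omega$, $\mathcal{X}^L(s_0,x_0)$ is the set of $x\in\Omega$ with $x=x_0$ on $[0,s_0]$, $x|_{[s_0,T]}$ absolutely continuous, and $|x'(t)|\le L(1+\sup_{s\le t}|x(s)|)$ a.e. on $(s_0,T)$. For $y_0\in\mathbb{R}$, $z\in\mathbb{R}^d$, $\mathcal{Y}^L(s_0,x_0,y_0,z)$ is the set of pairs $(x,y)\in\mathcal{X}^L(s_0,x_0)\times C([s_0,T])$ with $y(t)=y_0+\int_{s_0}^t[x'(s)\cdot z-H(s,x,y(s),z)]\,ds$ on $[s_0,T]$. Minimax semisolutions of the terminal-value problem. Let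 $L\ge0$ and $u:[0,T]\times\Omega\to\mathbb{R}$. - $u$ is a minimax $L$-supersolution if $u$ is LSC, $u(T,\cdot)\ge h$ on $\Omega$, and for every $(s_0,x_0,z)\in[0,T)\times\Omega\times\mathbb{R}^d$ and every $y_0\ge u(s_0,x_0)$ there is $(x,y)\in\mathcal{Y}^L(s_0,x_0,y_0,z)$ with $y(t)\ge u(t,x)$ for each $t\in[s_0,T]$. - $u$ is a minimax $L$-subsolution if $u$ is USC, $u(T,\cdot)\le h$ on $\Omega$, and for every $(s_0,x_0,z)\in[0,T)\times\Omega\times\mathbb{R}^d$ and every $y_0\le u(s_0,x_0)$ there is $(x,y)\in\mathcal{Y}^L(s_0,x_0,y_0,z)$ with $y(t)\le u(t,x)$ for each $t\in[s_0,T]$. *)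

theory Defs
  imports "HOL-Analysis.Analysis"
begin

section \<open>Path space\<close>

text \<open>
  A function on \<open>[0,T]\<close> is represented by its extension to the real line that is
  \<^term>\<open>undefined\<close> off \<open>[0,T]\<close>, so that equality of paths is equality on \<open>[0,T]\<close>.
\<close>

definition cadlag_paths :: "real \<Rightarrow> (real \<Rightarrow> real^'d) set"  (\<open>\<Omega>\<close>) where
  "\<Omega> T = {x \<in> extensional {0..T}.
      (\<forall>t\<in>{0..<T}. (x \<longlongrightarrow> x t) (at_right t)) \<and>
      (\<forall>t\<in>{0<..T}. \<exists>l. (x \<longlongrightarrow> l) (at_left t))}"

text \<open>The real suprema below are taken over bounded sets, hence are genuine least upper bounds.\<close>

lemma cadlag_paths_bounded:
  assumes "x \<in> \<Omega> T"
  shows "bounded (x ` {0..T})"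
proof -
  have loc: "\<exists>U. open U \<and> t \<in> U \<and> bounded (x ` (U \<inter> {0..T}))" if t: "t \<in> {0..T}" for t
  proof -
    have R: "\<exists>b>t. bounded (x ` ({t<..<b} \<inter> {0..T}))"
    proof (cases "t < T")
      case True
      then have "(x \<longlongrightarrow> x t) (at_right t)"
        using assms t by (auto simp: cadlag_paths_def)
      then have "eventually (\<lambda>s. dist (x s) (x t) < 1) (at_right t)"
        by (rule tendstoD) simp
      then obtain b where b: "b > t" "\<And>s. t < s \<Longrightarrow> s < b \<Longrightarrow> dist (x s) (x t) < 1"
        by (auto simp: eventually_at_right_field)
      have "x ` ({t<..<b} \<inter> {0..T}) \<subseteq> cball (x t) 1"
        using b(2) by (force simp: dist_commute)
      then show ?thesis using b(1) bounded_cball bounded_subset by blast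
    next
      case False
      then have "{t<..<t + 1} \<inter> {0..T} = {}" by auto
      then have "bounded (x ` ({t<..<t + 1} \<inter> {0..T}))" by simp
      then show ?thesis by (intro exI[of _ "t + 1"]) auto
    qed
    have L: "\<exists>a<t. bounded (x ` ({a<..<t} \<inter> {0..T}))"
    proof (cases "0 < t")
      case True
      then have "t \<in> {0<..T}" using t by simp
      then obtain l where "(x \<longlongrightarrow> l) (at_left t)"
        using assms unfolding cadlag_paths_def by blast
      then have "eventually (\<lambda>s. dist (x s) l < 1) (at_left t)"
        by (rule tendstoD) simp
      then obtain a where a: "a < t" "\<And>s. a < s \<Longrightarrow> s < t \<Longrightarrow> dist (x s) l < 1"
        by (auto simp: eventually_at_left_field)
      have "x ` ({a<..<t} \<inter> {0..T}) \<subseteq> cball l 1"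
        using a(2) by (force simp: dist_commute)
      then show ?thesis using a(1) bounded_cball bounded_subset by blast
    next
      case False
      then have "{t - 1<..<t} \<inter> {0..T} = {}" by auto
      then have "bounded (x ` ({t - 1<..<t} \<inter> {0..T}))" by simp
      then show ?thesis by (intro exI[of _ "t - 1"]) auto
    qed
    obtain a b where ab: "a < t" "t < b"
      and bd: "bounded (x ` ({a<..<t} \<inter> {0..T}))" "bounded (x ` ({t<..<b} \<inter> {0..T}))"
      using L R by blast
    have "{a<..<b} \<inter> {0..T} \<subseteq> insert t (({a<..<t} \<inter> {0..T}) \<union> ({t<..<b} \<inter> {0..T}))"
      by auto
    then have "x ` ({a<..<b} \<inter> {0..T}) \<subseteq>
        insert (x t) (x ` ({a<..<t} \<inter> {0..T}) \<union> x ` ({t<..<b} \<inter> {0..T}))"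
      by blast
    moreover have "bounded (insert (x t) (x ` ({a<..<t} \<inter> {0..T}) \<union> x ` ({t<..<b} \<inter> {0..T})))"
      using bd by simp
    ultimately have "bounded (x ` ({a<..<b} \<inter> {0..T}))"
      using bounded_subset by blast
    then show ?thesis using ab by (intro exI[of _ "{a<..<b}"]) auto
  qed
  then obtain U where U: "\<And>t. t \<in> {0..T} \<Longrightarrow> open (U t) \<and> t \<in> U t \<and> bounded (x ` (U t \<inter> {0..T}))"
    by metis
  obtain C where C: "C \<subseteq> {0..T}" "finite C" "{0..T} \<subseteq> (\<Union>t\<in>C. U t)"
    using compactE_image[of "{0..T}" "{0..T}" U] U by (metis UN_I compact_Icc subsetI)
  have "x ` {0..T} \<subseteq> (\<Union>t\<in>C. x ` (U t \<inter> {0..T}))"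
    using C(3) by blast
  moreover have "bounded (\<Union>t\<in>C. x ` (U t \<inter> {0..T}))"
    using C U by (intro bounded_UN) auto
  ultimately show ?thesis
    using bounded_subset by blast
qed

definition sup_dist :: "real \<Rightarrow> (real \<Rightarrow> real^'d) \<Rightarrow> (real \<Rightarrow> real^'d) \<Rightarrow> real" where
  "sup_dist T x x' = (SUP r\<in>{0..T}. norm (x r - x' r))"

definition running_sup :: "(real \<Rightarrow> real^'d) \<Rightarrow> real \<Rightarrow> real" where
  "running_sup x t = (SUP s\<in>{0..t}. norm (x s))"

definition d_infty :: "real \<Rightarrow> real \<Rightarrow> (real \<Rightarrow> real^'d) \<Rightarrow> real \<Rightarrow> (real \<Rightarrow> real^'d) \<Rightarrow> real" where
  "d_infty T t x s x' = \<bar>t - s\<bar> + (SUP r\<in>{0..T}. norm (x (min r t) - x' (min r s)))"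

definition LSC :: "real \<Rightarrow> (real \<Rightarrow> (real \<Rightarrow> real^'d) \<Rightarrow> real) \<Rightarrow> bool" where
  "LSC T u \<longleftrightarrow> (\<forall>t\<in>{0..T}. \<forall>x\<in>\<Omega> T. \<forall>\<epsilon>>0. \<exists>\<delta>>0. \<forall>s\<in>{0..T}. \<forall>x'\<in>\<Omega> T.
      d_infty T t x s x' < \<delta> \<longrightarrow> u s x' > u t x - \<epsilon>)"

definition USC :: "real \<Rightarrow> (real \<Rightarrow> (real \<Rightarrow> real^'d) \<Rightarrow> real) \<Rightarrow> bool" where
  "USC T u \<longleftrightarrow> (\<forall>t\<in>{0..T}. \<forall>x\<in>\<Omega> T. \<forall>\<epsilon>>0. \<exists>\<delta>>0. \<forall>s\<in>{0..T}. \<forall>x'\<in>\<Omega> T.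
      d_infty T t x s x' < \<delta> \<longrightarrow> u s x' < u t x + \<epsilon>)"


section \<open>Path sets\<close>

text \<open>
  An element \<open>(a, b)\<close> of \<open>I\<close> stands for the interval \<open>[a,b]\<close>; only the interiors have to be
  disjoint.
\<close>

definition abs_continuous_on_Icc :: "(real \<Rightarrow> real^'d) \<Rightarrow> real \<Rightarrow> real \<Rightarrow> bool" where
  "abs_continuous_on_Icc f \<alpha> \<beta> \<longleftrightarrow> (\<forall>\<epsilon>>0. \<exists>\<delta>>0. \<forall>I :: (real \<times> real) set.
      finite I \<and> (\<forall>(a, b)\<in>I. \<alpha> \<le> a \<and> a \<le> b \<and> b \<le> \<beta>) \<and>
      disjoint_family_on (\<lambda>(a, b). {a<..<b}) I \<and> (\<Sum>(a, b)\<in>I. b - a) < \<delta> \<longrightarrow>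
      (\<Sum>(a, b)\<in>I. norm (f b - f a)) < \<epsilon>)"

definition X_set :: "real \<Rightarrow> real \<Rightarrow> real \<Rightarrow> (real \<Rightarrow> real^'d) \<Rightarrow> (real \<Rightarrow> real^'d) set"  (\<open>\<X>\<close>) where
  "\<X> T L s0 x0 = {x \<in> \<Omega> T.
      (\<forall>t\<in>{0..s0}. x t = x0 t) \<and>
      abs_continuous_on_Icc x s0 T \<and>
      (AE t\<in>{s0<..<T} in lebesgue. x differentiable (at t) \<and>
        norm (vector_derivative x (at t)) \<le> L * (1 + running_sup x t))}"

text \<open>
  The integral is a Lebesgue integral. Its integrand is required to be integrable, because
  Isabelle's integral of a non-integrable function is \<open>0\<close>. Only the values of \<open>y\<close> on \<open>[s0,T]\<close>
  matter.
\<close>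

definition Y_set ::
  "real \<Rightarrow> (real \<Rightarrow> (real \<Rightarrow> real^'d) \<Rightarrow> real \<Rightarrow> real^'d \<Rightarrow> real) \<Rightarrow> real \<Rightarrow>
   real \<Rightarrow> (real \<Rightarrow> real^'d) \<Rightarrow> real \<Rightarrow> real^'d \<Rightarrow> ((real \<Rightarrow> real^'d) \<times> (real \<Rightarrow> real)) set"  (\<open>\<Y>\<close>) where
  "\<Y> T H L s0 x0 y0 z = {(x, y). x \<in> \<X> T L s0 x0 \<and> continuous_on {s0..T} y \<and>
      set_integrable lebesgue {s0..T} (\<lambda>s. vector_derivative x (at s) \<bullet> z - H s x (y s) z) \<and>
      (\<forall>t\<in>{s0..T}. y t = y0 +
        (LINT s:{s0..t}|lebesgue. vector_derivative x (at s) \<bullet> z - H s x (y s) z))}"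


section \<open>Standing assumptions on the data\<close>

definition continuous_terminal_cost :: "real \<Rightarrow> ((real \<Rightarrow> real^'d) \<Rightarrow> real) \<Rightarrow> bool" where
  "continuous_terminal_cost T h \<longleftrightarrow> (\<forall>x\<in>\<Omega> T. \<forall>\<epsilon>>0. \<exists>\<delta>>0. \<forall>x'\<in>\<Omega> T.
      sup_dist T x x' < \<delta> \<longrightarrow> \<bar>h x' - h x\<bar> < \<epsilon>)"

locale hamiltonian =
  fixes T :: real
    and H :: "real \<Rightarrow> (real \<Rightarrow> real^'d) \<Rightarrow> real \<Rightarrow> real^'d \<Rightarrow> real"
  assumes non_anticipating:
    "\<And>t x x' y z. t \<in> {0..T} \<Longrightarrow> x \<in> \<Omega> T \<Longrightarrow> x' \<in> \<Omega> T \<Longrightarrow> (\<forall>s\<in>{0..t}. x s = x' s) \<Longrightarrow>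
      H t x y z = H t x' y z"
  and continuous:
    "AE t\<in>{0<..<T} in lebesgue. \<forall>x\<in>\<Omega> T. \<forall>y z. \<forall>\<epsilon>>0. \<exists>\<delta>>0. \<forall>x'\<in>\<Omega> T. \<forall>y' z'.
      sup_dist T x x' < \<delta> \<and> \<bar>y' - y\<bar> < \<delta> \<and> norm (z' - z) < \<delta> \<longrightarrow>
      \<bar>H t x' y' z' - H t x y z\<bar> < \<epsilon>"
  and borel:
    "\<And>x y z. x \<in> \<Omega> T \<Longrightarrow> (\<lambda>t. H t x y z) \<in> borel_measurable (restrict_space borel {0..T})"
  and lipschitz_z:
    "\<exists>L\<^sub>H\<ge>0. AE t\<in>{0<..<T} in lebesgue. \<forall>x\<in>\<Omega> T. \<forall>y z z'.
      \<bar>H t x y z - H t x y z'\<bar> \<le> L\<^sub>H * (1 + running_sup x t) * norm (z - z')"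
  and lipschitz_x:
    "\<forall>L\<ge>0. \<exists>M\<ge>0. \<forall>t0\<in>{0..<T}. \<forall>x0\<in>\<Omega> T. \<forall>x\<in>\<X> T L t0 x0. \<forall>x'\<in>\<X> T L t0 x0. \<forall>y z.
      AE t\<in>{t0<..<T} in lebesgue.
        \<bar>H t x y z - H t x' y z\<bar> \<le> M * (1 + \<bar>y\<bar> + norm z) * running_sup (\<lambda>s. x s - x' s) t"
  and non_increasing:
    "AE t\<in>{0<..<T} in lebesgue. \<forall>x\<in>\<Omega> T. \<forall>z. antimono (\<lambda>y. H t x y z)"
  and growth:
    "\<exists>C\<ge>0. AE t\<in>{0<..<T} in lebesgue. \<forall>x\<in>\<Omega> T. \<forall>y.
      \<bar>H t x y 0\<bar> \<le> C * (1 + running_sup x t + \<bar>y\<bar>)"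


section \<open>Minimax semisolutions\<close>

definition minimax_supersolution ::
  "real \<Rightarrow> (real \<Rightarrow> (real \<Rightarrow> real^'d) \<Rightarrow> real \<Rightarrow> real^'d \<Rightarrow> real) \<Rightarrow> ((real \<Rightarrow> real^'d) \<Rightarrow> real) \<Rightarrow>
   real \<Rightarrow> (real \<Rightarrow> (real \<Rightarrow> real^'d) \<Rightarrow> real) \<Rightarrow> bool" where
  "minimax_supersolution T H h L u \<longleftrightarrow>
    LSC T u \<and> (\<forall>x\<in>\<Omega> T. u T x \<ge> h x) \<and>
    (\<forall>s0\<in>{0..<T}. \<forall>x0\<in>\<Omega> T. \<forall>z. \<forall>y0\<ge>u s0 x0.
      \<exists>(x, y)\<in>\<Y> T H L s0 x0 y0 z. \<forall>t\<in>{s0..T}. y t \<ge> u t x)"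

definition minimax_subsolution ::
  "real \<Rightarrow> (real \<Rightarrow> (real \<Rightarrow> real^'d) \<Rightarrow> real \<Rightarrow> real^'d \<Rightarrow> real) \<Rightarrow> ((real \<Rightarrow> real^'d) \<Rightarrow> real) \<Rightarrow>
   real \<Rightarrow> (real \<Rightarrow> (real \<Rightarrow> real^'d) \<Rightarrow> real) \<Rightarrow> bool" where
  "minimax_subsolution T H h L u \<longleftrightarrow>
    USC T u \<and> (\<forall>x\<in>\<Omega> T. u T x \<le> h x) \<and>
    (\<forall>s0\<in>{0..<T}. \<forall>x0\<in>\<Omega> T. \<forall>z. \<forall>y0\<le>u s0 x0.
      \<exists>(x, y)\<in>\<Y> T H L s0 x0 y0 z. \<forall>t\<in>{s0..T}. y t \<le> u t x)"

end

theory Submission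
  imports Defs "HOL-Complex_Analysis.Great_Picard"
begin

text \<open>
  Suppose that \<open>u\<close> exceeds \<open>v\<close> by \<open>\<delta> > 0\<close> at \<open>(s0, x0)\<close>. Both semisolutions come with characteristics:
  for any vector \<open>z\<close> there is one, \<open>(x, y)\<close>, with \<open>y\<close> below \<open>u\<close> along \<open>x\<close>, and one, \<open>(x', y')\<close>, with \<open>y'\<close>
  above \<open>v\<close> along \<open>x'\<close>. They are followed simultaneously from \<open>x0\<close> on a fine time grid, with the same \<open>z\<close>
  for both, which is updated at each grid time (extremal aiming in the theory of differential games).
  Let \<open>w = x - x'\<close> and let \<open>m\<close> be the running supremum of its norm. As long as \<open>y' \<le> y\<close>, monotonicity
  of \<open>H\<close> in \<open>y\<close> and the Lipschitz condition in \<open>x\<close> bound the derivative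
  of \<open>y - y'\<close> from below, almost everywhere, by \<open>w' \<bullet> z - M (1 + \<bar>y'\<bar> + \<bar>z\<bar>) m\<close>
  (\<open>Y_set_gap_lower_bound\<close>).

  The vector \<open>z\<close> is the gradient of a penalty \<open>c(t) \<Upsilon>(t, w)\<close>, so that the first term is
  the first-order change of the penalty. The penalty has to control \<open>m\<close>, and not just the present value
  of \<open>\<bar>w\<bar>\<close>, but must still have a gradient. This is achieved by \<open>\<Upsilon> = (m\<^sup>2 - a\<^sup>2)\<^sup>2 + a\<^sup>4\<close> with \<open>a = \<bar>w\<bar>\<close>,
  which is at least \<open>m\<^sup>4 / 2\<close> and whose derivative in \<open>m\<close> vanishes whenever \<open>m\<close> can grow
  (\<open>path_gauge_ge\<close>, \<open>path_gauge_step\<close>). The second term is absorbed by an exponential decay of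
  the weight \<open>c\<close>: the part with \<open>z\<close> is at most a multiple of \<open>c \<Upsilon>\<close>, because \<open>\<bar>z\<bar> m \<le> 4 c m\<^sup>4\<close>. So is the rest
  up to an error of order \<open>\<eta>\<close>, if \<open>c\<close> is of order \<open>\<eta>\<close> to the power \<open>-3\<close>, provided \<open>y'\<close> stays bounded.
  It does, because \<open>v \<le> y' \<le> y \<le> u\<close> and the semisolutions are bounded from the relevant sides on the
  relatively compact set of admissible paths (\<open>X_set_relatively_compact\<close>, \<open>USC_bounded_above\<close>).

  Summation over the grid (\<open>Y_set_gauge_step\<close>) yields \<open>y - y' - c \<Upsilon> \<ge> \<delta> / 2\<close> at time \<open>T\<close>.
  Thus \<open>h x - h x' \<ge> \<delta> / 2\<close>, while \<open>c \<Upsilon>\<close> is bounded and the paths become arbitrarily close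
  as \<open>\<eta>\<close> tends to \<open>0\<close>. This contradicts the uniform continuity of \<open>h\<close> on the set of admissible paths
  (\<open>terminal_cost_uniformly_continuous\<close>).
\<close>

section \<open>The fundamental theorem of calculus for absolutely continuous paths\<close>

text \<open>
  The fundamental theorem of calculus for the Henstock-Kurzweil integral. At a tag off \<open>N\<close> the
  increment of \<open>f\<close> over a small interval is almost \<open>f' t\<close> times its length. The intervals tagged
  in \<open>N\<close> lie in an open set of small measure, so absolute continuity makes the sum of their
  increments small.
\<close>

lemma abs_continuous_has_integral:
  fixes f :: "real \<Rightarrow> real^'d"
  assumes ab: "a \<le> b" and ac: "abs_continuous_on_Icc f a b"
    and N: "negligible N"
    and deriv: "\<And>t. t \<in> {a..b} - N \<Longrightarrow> (f has_vector_derivative f' t) (at t within {a..b})"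
  shows "(f' has_integral (f b - f a)) {a..b}"
proof -
  define g where "g t = (if t \<in> N then 0 else f' t)" for t
  have "(g has_integral (f b - f a)) {a..b}"
    unfolding has_integral_real
  proof (intro allI impI)
    fix e :: real assume e: "e > 0"
    define e1 where "e1 = e / (2 * (b - a + 1))"
    have e1: "e1 > 0" using e ab by (simp add: e1_def)
    have e1_le: "e1 * (b - a) < e / 2"
      using e ab by (simp add: e1_def field_simps)
    obtain \<delta> where \<delta>: "\<delta> > 0" and ac':
      "\<And>I. finite I \<Longrightarrow> (\<forall>(u, v)\<in>I. a \<le> u \<and> u \<le> v \<and> v \<le> b) \<Longrightarrow>
        disjoint_family_on (\<lambda>(u, v). {u<..<v}) I \<Longrightarrow> (\<Sum>(u, v)\<in>I. v - u) < \<delta> \<Longrightarrow>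
        (\<Sum>(u, v)\<in>I. norm (f v - f u)) < e / 2"
      using ac[unfolded abs_continuous_on_Icc_def, rule_format, OF half_gt_zero[OF e]] by blast
    obtain U where U: "open U" "N \<subseteq> U" "U \<in> lmeasurable" "measure lebesgue U < \<delta>"
    proof -
      have Ns: "N \<in> sets lebesgue" and Nz: "emeasure lebesgue N = 0"
        using N by (auto simp: negligible_iff_null_sets null_sets_def)
      obtain U where U: "open U" "N \<subseteq> U" "U - N \<in> lmeasurable" "emeasure lebesgue (U - N) < ennreal \<delta>"
        using sets_lebesgue_outer_open[OF Ns \<delta>] by blast
      have "U = (U - N) \<union> N" using U(2) by auto
      then have "emeasure lebesgue U = emeasure lebesgue (U - N)"
        by (metis N U(3) emeasure_Un_null_set fmeasurableD negligible_iff_null_sets)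
      then have lt: "emeasure lebesgue U < ennreal \<delta>" using U(4) by simp
      have Us: "U \<in> sets lebesgue" using U(1) by auto
      have "U \<in> lmeasurable"
        using lt Us by (intro fmeasurableI) (auto intro: order.strict_trans)
      moreover have "measure lebesgue U < \<delta>"
        using lt \<delta> by (simp add: emeasure_eq_measure2 calculation ennreal_less_iff)
      ultimately show thesis using U that by blast
    qed
    have "\<exists>d>0. (t \<in> N \<longrightarrow> ball t d \<subseteq> U) \<and> (t \<in> {a..b} - N \<longrightarrow>
        (\<forall>s\<in>{a..b}. norm (s - t) < d \<longrightarrow> norm (f s - f t - (s - t) *\<^sub>R f' t) \<le> e1 * norm (s - t)))" for t
    proof (cases "t \<in> N")
      case True
      then show ?thesis using U(1,2) open_contains_ball by (metis DiffD2 subsetD)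
    next
      case False
      show ?thesis
      proof (cases "t \<in> {a..b}")
        case True
        then show ?thesis
          using deriv[of t] e1 False unfolding has_vector_derivative_def has_derivative_within_alt
          by (metis DiffI)
      qed (auto simp: False intro: exI[of _ 1])
    qed
    then obtain d where d: "\<And>t. d t > 0" "\<And>t. t \<in> N \<Longrightarrow> ball t (d t) \<subseteq> U"
      "\<And>t s. t \<in> {a..b} - N \<Longrightarrow> s \<in> {a..b} \<Longrightarrow> norm (s - t) < d t \<Longrightarrow>
         norm (f s - f t - (s - t) *\<^sub>R f' t) \<le> e1 * norm (s - t)"
      by metis
    show "\<exists>\<gamma>. gauge \<gamma> \<and> (\<forall>\<D>. \<D> tagged_division_of {a..b} \<and> \<gamma> fine \<D> \<longrightarrow>
        norm (sum (\<lambda>(x,k). measure lborel k *\<^sub>R g x) \<D> - (f b - f a)) < e)"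
    proof (intro exI conjI allI impI)
      show "gauge (\<lambda>t. ball t (d t))" using d(1) gauge_ball_dependent by blast
    next
      fix p assume "p tagged_division_of {a..b} \<and> (\<lambda>t. ball t (d t)) fine p"
      then have ptag: "p tagged_division_of {a..b}" and fine: "(\<lambda>t. ball t (d t)) fine p" by auto
      have fin: "finite p" using ptag by blast
      have K: "\<exists>u v. K = {u..v} \<and> u \<le> v \<and> t \<in> {u..v} \<and> a \<le> u \<and> v \<le> b \<and> {u..v} \<subseteq> ball t (d t)"
        if tK: "(t, K) \<in> p" for t K
      proof -
        have "t \<in> K" "K \<subseteq> {a..b}" using ptag tK by blast+
        moreover obtain u v where "K = cbox u v" using tagged_division_ofD(4)[OF ptag tK] by blast
        moreover have "K \<subseteq> ball t (d t)" using fine tK by blast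
        ultimately show ?thesis by (intro exI[of _ u] exI[of _ v]) auto
      qed
      have ba: "b - a = (\<Sum>(t,K)\<in>p. Sup K - Inf K)" "f b - f a = (\<Sum>(t,K)\<in>p. f(Sup K) - f(Inf K))"
        using additive_tagged_division_1[where f= "\<lambda>x. x"] additive_tagged_division_1[where f= f]
              \<open>a \<le> b\<close> ptag by auto
      define B where "B = {i \<in> p. fst i \<in> N}"
      have B: "finite B" "B \<subseteq> p" using fin by (auto simp: B_def)
      have good: "norm (measure lborel K *\<^sub>R g t - (f (Sup K) - f (Inf K))) \<le> e1 * (Sup K - Inf K)"
        if tK: "(t, K) \<in> p - B" for t K
      proof -
        obtain u v where uv: "K = {u..v}" "u \<le> v" "t \<in> {u..v}" "a \<le> u" "v \<le> b" "{u..v} \<subseteq> ball t (d t)"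
          using K tK by blast
        have tN: "t \<in> {a..b} - N" using tK uv by (auto simp: B_def)
        have "dist t u < d t" "dist t v < d t" using uv by (auto simp: subset_eq)
        then have dl: "norm (u - t) < d t" "norm (v - t) < d t" by (auto simp: dist_norm norm_minus_commute)
        have u: "norm (f u - f t - (u - t) *\<^sub>R f' t) \<le> e1 * norm (u - t)"
          using uv dl by (intro d(3)[OF tN]) auto
        have v: "norm (f v - f t - (v - t) *\<^sub>R f' t) \<le> e1 * norm (v - t)"
          using uv dl by (intro d(3)[OF tN]) auto
        have "norm ((v - u) *\<^sub>R f' t - (f v - f u)) =
            norm ((f u - f t - (u - t) *\<^sub>R f' t) - (f v - f t - (v - t) *\<^sub>R f' t))"
          by (auto simp: algebra_simps)
        also have "\<dots> \<le> e1 * norm (u - t) + e1 * norm (v - t)"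
          using u v norm_triangle_ineq4 order_trans by (meson add_mono)
        also have "\<dots> = e1 * (v - u)" using uv by (simp add: algebra_simps)
        finally show ?thesis using uv tN by (simp add: g_def)
      qed
      \<comment> \<open>The definition of absolute continuity speaks of pairs of endpoints instead of intervals.
        Tagged intervals with the same endpoints also have the same tag, since otherwise they would have
        disjoint interiors or be a single point; so no summand is lost.\<close>
      define \<iota> where "\<iota> = (\<lambda>(t::real, K::real set). (Inf K, Sup K))"
      have inj: "inj_on \<iota> B"
      proof (rule inj_onI, clarify)
        fix t1 K1 t2 K2
        assume 1: "(t1, K1) \<in> B" and 2: "(t2, K2) \<in> B" and eq: "\<iota> (t1, K1) = \<iota> (t2, K2)"
        have p12: "(t1, K1) \<in> p" "(t2, K2) \<in> p" using 1 2 B by auto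
        obtain u v where uv: "K1 = {u..v}" "u \<le> v" "t1 \<in> {u..v}" using K p12 by blast
        obtain u2 v2 where uv2: "K2 = {u2..v2}" "u2 \<le> v2" "t2 \<in> {u2..v2}" using K p12 by blast
        have KK: "K1 = K2" using eq uv uv2 by (simp add: \<iota>_def)
        show "t1 = t2 \<and> K1 = K2"
        proof (cases "u = v")
          case True then show ?thesis using uv uv2 KK by auto
        next
          case False
          have "interior K1 \<inter> interior K2 \<noteq> {}" using uv False by (simp add: KK[symmetric])
          then show ?thesis using tagged_division_ofD(5)[OF ptag p12] KK by auto
        qed
      qed
      have disj: "disjoint_family_on (\<lambda>(u, v). {u<..<v}) (\<iota> ` B)"
      proof (unfold disjoint_family_on_def, intro ballI impI)
        fix i j assume i: "i \<in> \<iota> ` B" and j: "j \<in> \<iota> ` B" and ij: "i \<noteq> j"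
        obtain t1 K1 where 1: "(t1, K1) \<in> B" "i = \<iota> (t1, K1)" using i by auto
        obtain t2 K2 where 2: "(t2, K2) \<in> B" "j = \<iota> (t2, K2)" using j by auto
        have p12: "(t1, K1) \<in> p" "(t2, K2) \<in> p" using 1 2 B by auto
        obtain u v where uv: "K1 = {u..v}" "u \<le> v" "t1 \<in> {u..v}" using K p12 by blast
        obtain u2 v2 where uv2: "K2 = {u2..v2}" "u2 \<le> v2" "t2 \<in> {u2..v2}" using K p12 by blast
        have "(t1, K1) \<noteq> (t2, K2)" using ij 1 2 by auto
        then have "interior K1 \<inter> interior K2 = {}" using tagged_division_ofD(5)[OF ptag p12] by auto
        then show "(case i of (u, v) \<Rightarrow> {u<..<v}) \<inter> (case j of (u, v) \<Rightarrow> {u<..<v}) = {}"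
          using uv uv2 1 2 by (simp add: \<iota>_def)
      qed
      have \<iota>1: "u \<le> v \<and> a \<le> u \<and> v \<le> b \<and> {u<..<v} \<subseteq> U" if uv: "(u, v) \<in> \<iota> ` B" for u v
      proof -
        obtain t K' where tK: "(t, K') \<in> B" "(u, v) = \<iota> (t, K')" using uv by auto
        obtain u' v' where uv': "K' = {u'..v'}" "u' \<le> v'" "a \<le> u'" "v' \<le> b" "{u'..v'} \<subseteq> ball t (d t)"
          using K tK B by blast
        have "ball t (d t) \<subseteq> U" using tK by (intro d(2)) (auto simp: B_def)
        moreover have "u = u'" "v = v'" using tK uv' by (auto simp: \<iota>_def)
        moreover have "{u'<..<v'} \<subseteq> {u'..v'}" by auto
        ultimately show ?thesis using uv' by blast
      qed
      have "(\<Sum>(u, v)\<in>\<iota> ` B. v - u) = (\<Sum>i\<in>\<iota> ` B. measure lebesgue (case i of (u, v) \<Rightarrow> {u<..<v}))"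
        using \<iota>1 by (intro sum.cong) auto
      also have "\<dots> = measure lebesgue (\<Union>i\<in>\<iota> ` B. (case i of (u, v) \<Rightarrow> {u<..<v}))"
        using disj B \<iota>1 by (intro measure_finite_Union[symmetric]) auto
      also have "\<dots> \<le> measure lebesgue U"
      proof (rule measure_mono_fmeasurable[OF _ _ U(3)])
        show "(\<Union>i\<in>\<iota> ` B. (case i of (u, v) \<Rightarrow> {u<..<v})) \<subseteq> U" using \<iota>1 by fast
        have "open (\<Union>i\<in>\<iota> ` B. (case i of (u, v) \<Rightarrow> {u<..<v}))" by (intro open_UN) (auto simp: case_prod_unfold)
        then show "(\<Union>i\<in>\<iota> ` B. (case i of (u, v) \<Rightarrow> {u<..<v})) \<in> sets lebesgue" by simp
      qed
      finally have small: "(\<Sum>(u, v)\<in>\<iota> ` B. v - u) < \<delta>" using U by simp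
      have "(\<Sum>(u, v)\<in>\<iota> ` B. norm (f v - f u)) < e / 2"
      proof (rule ac'[OF _ _ disj small])
        show "finite (\<iota> ` B)" using B by simp
        show "\<forall>(u, v)\<in>\<iota> ` B. a \<le> u \<and> u \<le> v \<and> v \<le> b" using \<iota>1 by blast
      qed
      then have bad: "(\<Sum>(t, K)\<in>B. norm (f (Sup K) - f (Inf K))) < e / 2"
        by (subst (asm) sum.reindex[OF inj]) (simp add: \<iota>_def case_prod_unfold o_def)
      have "norm (sum (\<lambda>(x,k). measure lborel k *\<^sub>R g x) p - (f b - f a)) =
          norm (\<Sum>(t, K)\<in>p. measure lborel K *\<^sub>R g t - (f (Sup K) - f (Inf K)))"
        by (simp add: ba sum_subtractf case_prod_unfold)
      also have "\<dots> \<le> (\<Sum>(t, K)\<in>p. norm (measure lborel K *\<^sub>R g t - (f (Sup K) - f (Inf K))))"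
        by (rule order_trans[OF norm_sum]) (simp add: case_prod_unfold)
      also have "\<dots> = (\<Sum>(t, K)\<in>p - B. norm (measure lborel K *\<^sub>R g t - (f (Sup K) - f (Inf K))))
          + (\<Sum>(t, K)\<in>B. norm (measure lborel K *\<^sub>R g t - (f (Sup K) - f (Inf K))))"
        by (rule sum.subset_diff[OF B(2) fin])
      also have "\<dots> \<le> (\<Sum>(t, K)\<in>p. e1 * (Sup K - Inf K)) + (\<Sum>(t, K)\<in>B. norm (f (Sup K) - f (Inf K)))"
      proof (rule add_mono)
        have "(\<Sum>(t, K)\<in>p - B. norm (measure lborel K *\<^sub>R g t - (f (Sup K) - f (Inf K)))) \<le>
            (\<Sum>(t, K)\<in>p - B. e1 * (Sup K - Inf K))"
          using good by (intro sum_mono) auto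
        also have "\<dots> \<le> (\<Sum>(t, K)\<in>p. e1 * (Sup K - Inf K))"
        proof (rule sum_mono2[OF fin])
          fix i assume "i \<in> p - (p - B)"
          then show "0 \<le> (case i of (t, K) \<Rightarrow> e1 * (Sup K - Inf K))"
            using K[of "fst i" "snd i"] e1 by (auto simp: case_prod_unfold)
        qed auto
        finally show "(\<Sum>(t, K)\<in>p - B. norm (measure lborel K *\<^sub>R g t - (f (Sup K) - f (Inf K)))) \<le>
            (\<Sum>(t, K)\<in>p. e1 * (Sup K - Inf K))" .
        show "(\<Sum>(t, K)\<in>B. norm (measure lborel K *\<^sub>R g t - (f (Sup K) - f (Inf K)))) \<le>
            (\<Sum>(t, K)\<in>B. norm (f (Sup K) - f (Inf K)))"
          by (intro sum_mono) (auto simp: B_def g_def norm_minus_commute)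
      qed
      also have "(\<Sum>(t, K)\<in>p. e1 * (Sup K - Inf K)) = e1 * (b - a)"
        by (simp add: ba sum_distrib_left case_prod_unfold)
      finally show "norm (sum (\<lambda>(x,k). measure lborel k *\<^sub>R g x) p - (f b - f a)) < e"
        using bad e1_le by linarith
    qed
  qed
  then show ?thesis
    by (rule has_integral_spike[OF N, rotated]) (simp add: g_def)
qed

section \<open>A smooth gauge for the running supremum\<close>

lemma norm_le_running_sup:
  assumes "\<And>r. r \<in> {0..t} \<Longrightarrow> norm (x r) \<le> R" and "s \<in> {0..t}"
  shows "norm (x s) \<le> running_sup x t"
  unfolding running_sup_def
  by (rule cSUP_upper[OF assms(2) bdd_aboveI2[of _ _ R]]) (rule assms(1))

lemma running_sup_le:
  assumes "0 \<le> t" and "\<And>r. r \<in> {0..t} \<Longrightarrow> norm (x r) \<le> R"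
  shows "running_sup x t \<le> R"
  unfolding running_sup_def
  by (rule cSUP_least) (use assms in auto)

lemma running_sup_mono:
  assumes "0 \<le> t" "t \<le> t'" and "\<And>r. r \<in> {0..t'} \<Longrightarrow> norm (x r) \<le> R"
  shows "running_sup x t \<le> running_sup x t'"
  using assms by (intro running_sup_le norm_le_running_sup[where R=R]) auto

lemma running_sup_nonneg:
  assumes "0 \<le> t" and "\<And>r. r \<in> {0..t} \<Longrightarrow> norm (x r) \<le> R"
  shows "0 \<le> running_sup x t"
proof -
  have "norm (x 0) \<le> running_sup x t"
    by (rule norm_le_running_sup[where R=R]) (use assms in auto)
  then show ?thesis using norm_ge_zero order_trans by blast
qed

lemma running_sup_cong:
  assumes "\<And>s. s \<in> {0..t} \<Longrightarrow> x s = x' s"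
  shows "running_sup x t = running_sup x' t"
  unfolding running_sup_def using assms by (intro SUP_cong) auto

text \<open>
  With \<open>m\<close> the running supremum of \<open>\<bar>w\<bar>\<close> and \<open>a = \<bar>w t\<bar>\<close>, the function \<open>(m\<^sup>2 - a\<^sup>2)\<^sup>2 + a\<^sup>4\<close>
  is a smooth substitute for \<open>m\<^sup>4\<close>. Its derivative \<open>4 m (m\<^sup>2 - a\<^sup>2)\<close> in \<open>m\<close> vanishes for \<open>a = m\<close>.
  Since \<open>m\<close> grows only at times at which \<open>a = m\<close>, the functional varies along a path as if
  \<open>m\<close> were constant, that is, with its gradient in the current value \<open>w t\<close> alone. Being a polynomial,
  it needs no special treatment near \<open>m = 0\<close>.
\<close>

definition path_gauge :: "(real \<Rightarrow> real^'d) \<Rightarrow> real \<Rightarrow> real" where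
  "path_gauge w t = ((running_sup w t)\<^sup>2 - (norm (w t))\<^sup>2)\<^sup>2 + norm (w t) ^ 4"

definition path_gauge_grad :: "(real \<Rightarrow> real^'d) \<Rightarrow> real \<Rightarrow> real^'d" where
  "path_gauge_grad w t = (4 * (2 * (norm (w t))\<^sup>2 - (running_sup w t)\<^sup>2)) *\<^sub>R w t"

lemma path_gauge_ge: "running_sup w t ^ 4 / 2 \<le> path_gauge w t"
proof -
  have "path_gauge w t - running_sup w t ^ 4 / 2 = ((running_sup w t)\<^sup>2 - 2 * (norm (w t))\<^sup>2)\<^sup>2 / 2"
    unfolding path_gauge_def by (simp add: field_simps power2_eq_square power4_eq_xxxx)
  also have "\<dots> \<ge> 0" by simp
  finally show ?thesis by linarith
qed

lemma norm_path_gauge_grad_le: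
  assumes "0 \<le> t" and "\<And>r. r \<in> {0..t} \<Longrightarrow> norm (w r) \<le> R"
  shows "norm (path_gauge_grad w t) \<le> 4 * running_sup w t ^ 3"
proof -
  let ?m = "running_sup w t" and ?a = "norm (w t)"
  have a: "0 \<le> ?a" "?a \<le> ?m" using assms by (auto intro!: norm_le_running_sup[where R=R])
  have "?a\<^sup>2 \<le> ?m\<^sup>2" using a by (intro power_mono) auto
  then have "\<bar>2 * ?a\<^sup>2 - ?m\<^sup>2\<bar> \<le> ?m\<^sup>2" by (auto simp: abs_le_iff)
  then have "\<bar>2 * ?a\<^sup>2 - ?m\<^sup>2\<bar> * ?a \<le> ?m\<^sup>2 * ?m" using a by (intro mult_mono) auto
  moreover have "?m ^ 3 = ?m\<^sup>2 * ?m" by (simp add: power2_eq_square power3_eq_cube)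
  ultimately show ?thesis
    unfolding path_gauge_grad_def norm_scaleR abs_mult by simp
qed

text \<open>
  The first-order expansion in \<open>w t\<close>. The growth of \<open>m\<close> contributes only
  \<open>(m'\<^sup>2 - m\<^sup>2) (m'\<^sup>2 + m\<^sup>2 - 2 a'\<^sup>2)\<close>. If \<open>m\<close> grows, then \<open>m'\<close> is approached
  on \<open>[t, t']\<close> and exceeds neither \<open>m\<close> by more than \<open>\<Delta>\<close> nor \<open>a'\<close> by more than \<open>2 \<Delta>\<close>, so both factors
  are \<open>O(R \<Delta>)\<close>.
\<close>

lemma path_gauge_step:
  fixes w :: "real \<Rightarrow> real^'d"
  assumes t: "0 \<le> t" "t \<le> t'"
    and R: "\<And>r. r \<in> {0..t'} \<Longrightarrow> norm (w r) \<le> R"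
    and \<Delta>: "\<And>r. r \<in> {t..t'} \<Longrightarrow> norm (w r - w t) \<le> \<Delta>"
  shows "path_gauge w t' \<le> path_gauge w t + path_gauge_grad w t \<bullet> (w t' - w t) + 28 * R\<^sup>2 * \<Delta>\<^sup>2"
proof -
  define m m' a a' where "m = running_sup w t" and "m' = running_sup w t'"
    and "a = norm (w t)" and "a' = norm (w t')"
  define d where "d = w t' - w t"
  have nd: "norm d \<le> \<Delta>" using \<Delta>[of t'] t unfolding d_def by auto
  have \<Delta>0: "0 \<le> \<Delta>" by (rule order_trans[OF norm_ge_zero nd])
  have R0: "0 \<le> R" using R[of t'] t norm_ge_zero order_trans by (metis atLeastAtMost_iff order_refl)
  have aR: "0 \<le> a" "a \<le> R" "0 \<le> a'" "a' \<le> R" using R t by (auto simp: a_def a'_def)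
  have am: "a \<le> m" "a' \<le> m'" unfolding a_def a'_def m_def m'_def
    using t R by (auto intro!: norm_le_running_sup[where R=R])
  have mm: "m \<le> m'" unfolding m_def m'_def by (rule running_sup_mono[OF t R])
  have m'R: "m' \<le> R" unfolding m'_def using t R by (intro running_sup_le) auto
  have dR: "norm d \<le> 2 * R"
    using norm_triangle_ineq4[of "w t'" "w t"] aR unfolding d_def a_def a'_def by linarith
  have a'a: "\<bar>a' - a\<bar> \<le> norm d"
    unfolding a_def a'_def d_def by (rule norm_triangle_ineq3)
  define e where "e = a'\<^sup>2 - a\<^sup>2"
  have e: "e = 2 * (w t \<bullet> d) + (norm d)\<^sup>2"
    unfolding e_def a_def a'_def d_def power2_norm_eq_inner
    by (simp add: inner_diff_left inner_diff_right inner_commute)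
  have "\<bar>e\<bar> = \<bar>a' - a\<bar> * (a' + a)"
    using aR by (simp add: e_def power2_eq_square square_diff_square_factored abs_mult mult.commute)
  also have "\<dots> \<le> \<Delta> * (2 * R)" using a'a nd aR by (intro mult_mono) auto
  finally have "\<bar>e\<bar>\<^sup>2 \<le> (\<Delta> * (2 * R))\<^sup>2" by (intro power_mono) auto
  then have e2: "e\<^sup>2 \<le> 4 * R\<^sup>2 * \<Delta>\<^sup>2" by (simp add: power_mult_distrib mult_ac)
  have d2: "(norm d)\<^sup>2 \<le> \<Delta>\<^sup>2" using nd by (intro power_mono) auto
  have a2: "a\<^sup>2 \<le> R\<^sup>2" using aR by (intro power_mono) auto
  have "(norm d)\<^sup>2 * (4 * a\<^sup>2 - 2 * m\<^sup>2) \<le> (norm d)\<^sup>2 * (4 * R\<^sup>2)"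
    using a2 zero_le_power2[of m] by (intro mult_left_mono) (linarith, simp)
  also have "\<dots> \<le> \<Delta>\<^sup>2 * (4 * R\<^sup>2)" using d2 by (intro mult_right_mono) auto
  finally have d2': "(norm d)\<^sup>2 * (4 * a\<^sup>2 - 2 * m\<^sup>2) \<le> 4 * R\<^sup>2 * \<Delta>\<^sup>2" by (simp add: mult_ac)
  \<comment> \<open>The change of \<open>a\<close> for fixed \<open>m\<close>: the linear part in \<open>d\<close> is the gradient term.\<close>
  have "(m\<^sup>2 - a'\<^sup>2)\<^sup>2 + a' ^ 4 - ((m\<^sup>2 - a\<^sup>2)\<^sup>2 + a ^ 4) = e * (4 * a\<^sup>2 - 2 * m\<^sup>2) + 2 * e\<^sup>2"
    unfolding e_def by algebra
  also have "\<dots> = path_gauge_grad w t \<bullet> d + (norm d)\<^sup>2 * (4 * a\<^sup>2 - 2 * m\<^sup>2) + 2 * e\<^sup>2"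
    unfolding e path_gauge_grad_def m_def a_def by (simp add: algebra_simps)
  also have "\<dots> \<le> path_gauge_grad w t \<bullet> d + 12 * R\<^sup>2 * \<Delta>\<^sup>2"
    using d2' e2 by linarith
  finally have first: "(m\<^sup>2 - a'\<^sup>2)\<^sup>2 + a' ^ 4 - path_gauge w t \<le> path_gauge_grad w t \<bullet> d + 12 * R\<^sup>2 * \<Delta>\<^sup>2"
    unfolding path_gauge_def m_def a_def .
  \<comment> \<open>The change of \<open>m\<close> for fixed \<open>a'\<close>.\<close>
  have second: "(m'\<^sup>2 - a'\<^sup>2)\<^sup>2 - (m\<^sup>2 - a'\<^sup>2)\<^sup>2 \<le> 16 * R\<^sup>2 * \<Delta>\<^sup>2"
  proof (cases "m' \<le> m")
    case True
    then show ?thesis using mm by simp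
  next
    case False
    have bound: "norm (w r) \<le> max m (a + \<Delta>)" if r: "r \<in> {0..t'}" for r
    proof (cases "r \<le> t")
      case True
      then have "norm (w r) \<le> m" unfolding m_def using r t R by (intro norm_le_running_sup[where R=R]) auto
      then show ?thesis by simp
    next
      case False
      then have "norm (w r) \<le> a + \<Delta>"
        using \<Delta>[of r] r norm_triangle_ineq2[of "w r" "w t"] by (simp add: a_def)
      then show ?thesis by simp
    qed
    have "m' \<le> max m (a + \<Delta>)" unfolding m'_def using t bound by (intro running_sup_le) auto
    then have m': "m' \<le> a + \<Delta>" using False by auto
    have m0: "0 \<le> m" using aR am by linarith
    have 1: "0 \<le> m'\<^sup>2 - m\<^sup>2" using mm m0 by (simp add: power_mono)
    have "m'\<^sup>2 - m\<^sup>2 = (m' - m) * (m' + m)" by (simp add: power2_eq_square algebra_simps)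
    also have "\<dots> \<le> \<Delta> * (2 * R)" using m' am mm m'R m0 R0 \<Delta>0 by (intro mult_mono) auto
    finally have 2: "m'\<^sup>2 - m\<^sup>2 \<le> \<Delta> * (2 * R)" .
    have "m' - a' \<le> 2 * \<Delta>" using m' a'a nd by linarith
    then have "(m' - a') * (m' + a') \<le> 2 * \<Delta> * (2 * R)"
      using am m'R aR m0 R0 \<Delta>0 by (intro mult_mono) auto
    then have "m'\<^sup>2 - a'\<^sup>2 \<le> 4 * \<Delta> * R" by (simp add: power2_eq_square algebra_simps)
    then have 3: "m'\<^sup>2 + m\<^sup>2 - 2 * a'\<^sup>2 \<le> 8 * \<Delta> * R" using 1 by linarith
    have "(m'\<^sup>2 - a'\<^sup>2)\<^sup>2 - (m\<^sup>2 - a'\<^sup>2)\<^sup>2 = (m'\<^sup>2 - m\<^sup>2) * (m'\<^sup>2 + m\<^sup>2 - 2 * a'\<^sup>2)" by algebra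
    also have "\<dots> \<le> (m'\<^sup>2 - m\<^sup>2) * (8 * \<Delta> * R)" using 1 3 by (intro mult_left_mono)
    also have "\<dots> \<le> \<Delta> * (2 * R) * (8 * \<Delta> * R)" using 2 R0 \<Delta>0 by (intro mult_right_mono) auto
    finally show ?thesis by (simp add: power2_eq_square mult_ac)
  qed
  show ?thesis
    using first second unfolding path_gauge_def[of w t'] m'_def[symmetric] a'_def[symmetric] d_def
    by linarith
qed

lemma path_gauge_cong:
  assumes "0 \<le> t" "\<And>s. s \<in> {0..t} \<Longrightarrow> x s = x' s"
  shows "path_gauge x t = path_gauge x' t" "path_gauge_grad x t = path_gauge_grad x' t"
  using assms running_sup_cong[of t x x'] by (auto simp: path_gauge_def path_gauge_grad_def)

section \<open>Bounds for admissible paths\<close>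

lemma path_norm_bounded:
  assumes "x \<in> \<Omega> T"
  obtains R where "\<And>t. t \<in> {0..T} \<Longrightarrow> norm (x t) \<le> R"
  using cadlag_paths_bounded[OF assms] unfolding bounded_iff by blast

lemma abs_continuous_subinterval:
  assumes "abs_continuous_on_Icc f a b" "a \<le> a'" "b' \<le> b"
  shows "abs_continuous_on_Icc f a' b'"
  unfolding abs_continuous_on_Icc_def
proof (intro allI impI)
  fix \<epsilon> :: real assume "\<epsilon> > 0"
  then obtain \<delta> where \<delta>: "\<delta> > 0" and *:
      "\<And>I. finite I \<Longrightarrow> (\<forall>(u, v)\<in>I. a \<le> u \<and> u \<le> v \<and> v \<le> b) \<Longrightarrow>
        disjoint_family_on (\<lambda>(u, v). {u<..<v}) I \<Longrightarrow> (\<Sum>(u, v)\<in>I. v - u) < \<delta> \<Longrightarrow>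
        (\<Sum>(u, v)\<in>I. norm (f v - f u)) < \<epsilon>"
    using assms(1)[unfolded abs_continuous_on_Icc_def, rule_format, OF \<open>\<epsilon> > 0\<close>] by blast
  show "\<exists>\<delta>>0. \<forall>I. finite I \<and> (\<forall>(a, b)\<in>I. a' \<le> a \<and> a \<le> b \<and> b \<le> b') \<and>
      disjoint_family_on (\<lambda>(a, b). {a<..<b}) I \<and> (\<Sum>(a, b)\<in>I. b - a) < \<delta> \<longrightarrow>
      (\<Sum>(a, b)\<in>I. norm (f b - f a)) < \<epsilon>"
  proof (rule exI[of _ \<delta>], intro conjI allI impI \<delta>, elim conjE)
    fix I :: "(real \<times> real) set"
    assume I: "finite I" "\<forall>(a, b)\<in>I. a' \<le> a \<and> a \<le> b \<and> b \<le> b'"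
      "disjoint_family_on (\<lambda>(a, b). {a<..<b}) I" "(\<Sum>(a, b)\<in>I. b - a) < \<delta>"
    have "\<forall>(u, v)\<in>I. a \<le> u \<and> u \<le> v \<and> v \<le> b" using I(2) assms(2,3) by fastforce
    then show "(\<Sum>(a, b)\<in>I. norm (f b - f a)) < \<epsilon>" using I * by blast
  qed
qed

lemma lipschitz_imp_abs_continuous:
  assumes "0 \<le> \<Lambda>" and lip: "\<And>s t. s \<in> {a..b} \<Longrightarrow> t \<in> {a..b} \<Longrightarrow> norm (f t - f s) \<le> \<Lambda> * \<bar>t - s\<bar>"
  shows "abs_continuous_on_Icc f a b"
  unfolding abs_continuous_on_Icc_def
proof (intro allI impI)
  fix \<epsilon> :: real assume \<epsilon>: "\<epsilon> > 0"
  show "\<exists>\<delta>>0. \<forall>I. finite I \<and> (\<forall>(u, v)\<in>I. a \<le> u \<and> u \<le> v \<and> v \<le> b) \<and>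
      disjoint_family_on (\<lambda>(u, v). {u<..<v}) I \<and> (\<Sum>(u, v)\<in>I. v - u) < \<delta> \<longrightarrow>
      (\<Sum>(u, v)\<in>I. norm (f v - f u)) < \<epsilon>"
  proof (rule exI[of _ "\<epsilon> / (\<Lambda> + 1)"], intro conjI allI impI, goal_cases)
    case 1 then show ?case using \<epsilon> assms(1) by simp
  next
    case (2 I)
    have "(\<Sum>(u, v)\<in>I. norm (f v - f u)) \<le> (\<Sum>(u, v)\<in>I. \<Lambda> * (v - u))"
    proof (rule sum_mono)
      fix i assume "i \<in> I"
      then have "a \<le> fst i \<and> fst i \<le> snd i \<and> snd i \<le> b" using 2 by (auto simp: case_prod_unfold)
      then show "(case i of (u, v) \<Rightarrow> norm (f v - f u)) \<le> (case i of (u, v) \<Rightarrow> \<Lambda> * (v - u))"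
        using lip[of "fst i" "snd i"] by (auto simp: case_prod_unfold)
    qed
    also have "\<dots> = \<Lambda> * (\<Sum>(u, v)\<in>I. v - u)" by (simp add: sum_distrib_left case_prod_unfold)
    also have "\<dots> \<le> \<Lambda> * (\<epsilon> / (\<Lambda> + 1))" using 2 assms(1) by (intro mult_left_mono) auto
    also have "\<dots> < \<epsilon>" using assms(1) \<epsilon> by (simp add: field_simps)
    finally show ?case .
  qed
qed

lemma AE_lebesgue_negligible:
  assumes "AE t in lebesgue. P t"
  shows "\<exists>N. negligible N \<and> (\<forall>t. t \<notin> N \<longrightarrow> P t)"
  using AE_E3[OF assms] by (auto simp: negligible_iff_null_sets)

lemma X_set_has_integral:
  assumes x: "x \<in> \<X> T L s0 x0" and ab: "s0 \<le> a" "a \<le> b" "b \<le> T"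
  shows "((\<lambda>s. vector_derivative x (at s)) has_integral (x b - x a)) {a..b}"
proof -
  have "AE t in lebesgue. t \<in> {s0<..<T} \<longrightarrow> x differentiable (at t)"
    using x unfolding X_set_def by (auto elim!: eventually_mono)
  then obtain N where N: "negligible N"
    "\<And>t. t \<notin> N \<Longrightarrow> t \<in> {s0<..<T} \<longrightarrow> x differentiable (at t)"
    using AE_lebesgue_negligible by blast
  show ?thesis
  proof (rule abs_continuous_has_integral[of _ _ _ "N \<union> {s0, T}"])
    show "abs_continuous_on_Icc x a b"
      using x ab by (auto simp: X_set_def intro: abs_continuous_subinterval)
    show "negligible (N \<union> {s0, T})" using N(1) by (auto intro: negligible_Un)
    fix t assume t: "t \<in> {a..b} - (N \<union> {s0, T})"
    then have "t \<in> {s0<..<T}" using ab by auto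
    then have "x differentiable (at t)" using N(2)[of t] t by auto
    then show "(x has_vector_derivative vector_derivative x (at t)) (at t within {a..b})"
      using vector_derivative_works has_vector_derivative_at_within by blast
  qed (use ab in auto)
qed

lemma X_set_increment:
  assumes x: "x \<in> \<X> T L s0 x0" and L: "0 \<le> L" and ab: "0 \<le> s0" "s0 \<le> a" "a \<le> b" "b \<le> T"
  shows "norm (x b - x a) \<le> L * (1 + running_sup x b) * (b - a)"
proof -
  have "x \<in> \<Omega> T" using x by (simp add: X_set_def)
  then obtain R where R: "\<And>t. t \<in> {0..T} \<Longrightarrow> norm (x t) \<le> R"
    using path_norm_bounded by blast
  have "AE t in lebesgue. t \<in> {s0<..<T} \<longrightarrow> norm (vector_derivative x (at t)) \<le> L * (1 + running_sup x t)"
    using x unfolding X_set_def by (auto elim!: eventually_mono)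
  then obtain N where N: "negligible N"
    "\<And>t. t \<notin> N \<Longrightarrow> t \<in> {s0<..<T} \<longrightarrow>
      norm (vector_derivative x (at t)) \<le> L * (1 + running_sup x t)"
    using AE_lebesgue_negligible by blast
  define N' where "N' = N \<union> {s0, T}"
  have N': "negligible N'" using N(1) unfolding N'_def by (auto intro: negligible_Un)
  define g where "g t = (if t \<in> N' then 0 else vector_derivative x (at t))" for t
  have "(g has_integral (x b - x a)) {a..b}"
    by (rule has_integral_spike[OF N' _ X_set_has_integral[OF x ab(2-4)]]) (simp add: g_def)
  moreover have rs: "0 \<le> running_sup x b" using ab R by (intro running_sup_nonneg[where R=R]) auto
  moreover have "norm (g t) \<le> L * (1 + running_sup x b)" if t: "t \<in> {a..b}" for t
  proof (cases "t \<in> N'")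
    case True then show ?thesis using L rs by (simp add: g_def)
  next
    case False
    then have "t \<in> {s0<..<T}" using ab t by (auto simp: N'_def)
    then have "norm (g t) \<le> L * (1 + running_sup x t)"
      using False N(2)[of t] by (auto simp: g_def N'_def)
    also have "\<dots> \<le> L * (1 + running_sup x b)"
      using t ab R L by (intro mult_left_mono add_left_mono running_sup_mono[where R=R]) auto
    finally show ?thesis .
  qed
  ultimately have "norm (x b - x a) \<le> L * (1 + running_sup x b) * measure lborel {a..b}"
    using L by (intro has_integral_bound_real[of _ "{}" g]) auto
  then show ?thesis using ab by simp
qed

text \<open>
  Gronwall's inequality in discrete form. Over a time \<open>\<tau>\<close> with \<open>L \<tau> \<le> 1/2\<close> the speed bound at the
  end of the interval gives \<open>\<rho>' \<le> \<rho> + (1 + \<rho>') / 2\<close> for the running suprema, so \<open>1 + \<rho>\<close> at most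
  doubles, and the number of such intervals depends on \<open>L\<close> and \<open>T - s0\<close> only.
\<close>

lemma X_set_bounded:
  assumes L: "0 \<le> L" and s0: "0 \<le> s0" "s0 < T"
  obtains R where "0 \<le> R" "\<And>x t. x \<in> \<X> T L s0 x0 \<Longrightarrow> t \<in> {0..T} \<Longrightarrow> norm (x t) \<le> R"
proof -
  obtain n :: nat where "2 * L * (T - s0) + 1 < real n" using reals_Archimedean2 by blast
  moreover have "0 \<le> 2 * L * (T - s0)" using L s0 by simp
  ultimately have n: "n > 0" "2 * L * (T - s0) \<le> real n" by linarith+
  define \<tau> where "\<tau> = (T - s0) / n"
  have \<tau>: "\<tau> > 0" "L * \<tau> \<le> 1 / 2" "real n * \<tau> = T - s0"
    using n s0 L by (auto simp: \<tau>_def field_simps)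
  define R where "R = 2 ^ n * (1 + running_sup x0 s0)"
  have main: "norm (x t) \<le> R" if x: "x \<in> \<X> T L s0 x0" and t: "t \<in> {0..T}" for x t
  proof -
    have "x \<in> \<Omega> T" using x by (simp add: X_set_def)
    then obtain S where S: "\<And>t. t \<in> {0..T} \<Longrightarrow> norm (x t) \<le> S"
      using path_norm_bounded by blast
    have ind: "1 + running_sup x (s0 + real i * \<tau>) \<le> 2 ^ i * (1 + running_sup x0 s0)" if "i \<le> n" for i
      using that
    proof (induction i)
      case 0
      have "running_sup x s0 = running_sup x0 s0" using x by (intro running_sup_cong) (auto simp: X_set_def)
      then show ?case by simp
    next
      case (Suc i)
      define a b where "a = s0 + real i * \<tau>" and "b = s0 + real (Suc i) * \<tau>"
      have "real (Suc i) * \<tau> \<le> real n * \<tau>" using Suc.prems \<tau> by (intro mult_right_mono) auto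
      then have ab: "s0 \<le> a" "a \<le> b" "b \<le> T" "b - a = \<tau>" using \<tau>
        by (auto simp: a_def b_def algebra_simps)
      have rs: "0 \<le> running_sup x b" using ab s0 S by (intro running_sup_nonneg[where R=S]) auto
      have "running_sup x b \<le> running_sup x a + (1 / 2) * (1 + running_sup x b)"
      proof (rule running_sup_le)
        show "0 \<le> b" using ab s0 by simp
        fix r assume r: "r \<in> {0..b}"
        show "norm (x r) \<le> running_sup x a + (1 / 2) * (1 + running_sup x b)"
        proof (cases "r \<le> a")
          case True
          then have "norm (x r) \<le> running_sup x a"
            using r ab S by (intro norm_le_running_sup[where R=S]) auto
          then show ?thesis using rs by (simp add: field_simps)
        next
          case False
          have "norm (x a) \<le> running_sup x a"
            using s0 ab S by (intro norm_le_running_sup[where R=S]) auto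
          moreover have "norm (x r - x a) \<le> L * (1 + running_sup x r) * (r - a)"
            using False r ab s0 by (intro X_set_increment[OF x L]) auto
          moreover have "\<dots> \<le> L * (1 + running_sup x b) * \<tau>"
            using False r ab S L rs s0
            by (intro mult_mono mult_left_mono add_left_mono running_sup_mono[where R=S]
                mult_nonneg_nonneg) auto
          moreover have "\<dots> = (L * \<tau>) * (1 + running_sup x b)" by simp
          moreover have "\<dots> \<le> (1 / 2) * (1 + running_sup x b)"
            using \<tau> rs by (intro mult_right_mono) auto
          ultimately show ?thesis using norm_triangle_ineq2[of "x r" "x a"] by linarith
        qed
      qed
      then have "1 + running_sup x b \<le> 2 * (1 + running_sup x a)" by (simp add: field_simps)
      also have "\<dots> \<le> 2 * (2 ^ i * (1 + running_sup x0 s0))"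
        using Suc unfolding a_def by simp
      finally show ?case unfolding b_def by simp
    qed
    have "1 + running_sup x T \<le> R" using ind[of n] \<tau>(3) by (simp add: R_def)
    moreover have "norm (x t) \<le> running_sup x T" using t S by (intro norm_le_running_sup[where R=S]) auto
    ultimately show ?thesis by simp
  qed
  show thesis
    by (rule that[of "max 0 R"]) (use main in \<open>auto simp: max.coboundedI2\<close>)
qed

lemma X_set_bounded_lipschitz:
  assumes L: "0 \<le> L" and s0: "0 \<le> s0" "s0 < T"
  obtains R \<Lambda> where "0 \<le> R" "0 \<le> \<Lambda>"
    "\<And>x t. x \<in> \<X> T L s0 x0 \<Longrightarrow> t \<in> {0..T} \<Longrightarrow> norm (x t) \<le> R"
    "\<And>x s t. x \<in> \<X> T L s0 x0 \<Longrightarrow> s \<in> {s0..T} \<Longrightarrow> t \<in> {s0..T} \<Longrightarrow> norm (x t - x s) \<le> \<Lambda> * \<bar>t - s\<bar>"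
proof -
  obtain R where R: "0 \<le> R" "\<And>x t. x \<in> \<X> T L s0 x0 \<Longrightarrow> t \<in> {0..T} \<Longrightarrow> norm (x t) \<le> R"
    using X_set_bounded[OF L s0] by metis
  have *: "norm (x t - x s) \<le> L * (1 + R) * (t - s)"
    if x: "x \<in> \<X> T L s0 x0" and "s0 \<le> s" "s \<le> t" "t \<le> T" for x s t
  proof -
    have "norm (x t - x s) \<le> L * (1 + running_sup x t) * (t - s)"
      using that s0 L by (intro X_set_increment)
    also have "\<dots> \<le> L * (1 + R) * (t - s)"
      using that s0 L R(2)[OF x]
      by (intro mult_right_mono mult_left_mono add_left_mono running_sup_le) auto
    finally show ?thesis .
  qed
  have **: "norm (x t - x s) \<le> L * (1 + R) * \<bar>t - s\<bar>"
    if "x \<in> \<X> T L s0 x0" "s \<in> {s0..T}" "t \<in> {s0..T}" for x s t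
    using *[OF that(1), of s t] *[OF that(1), of t s] that(2,3)
    by (cases "s \<le> t") (auto simp: norm_minus_commute)
  show thesis by (rule that[of R "L * (1 + R)"]) (use R ** L in auto)
qed

text \<open>
  Admissible continuations of admissible paths are admissible. This is what allows the driving
  vector of a characteristic to change at each point of a time grid. Absolute continuity across
  \<open>s1\<close> is inherited from the Lipschitz bounds on the two sides.
\<close>

lemma X_set_concat:
  assumes L: "0 \<le> L" and s: "0 \<le> s0" "s0 \<le> s1" "s1 < T"
    and x: "x \<in> \<X> T L s0 x0" and x': "x' \<in> \<X> T L s1 x"
  shows "x' \<in> \<X> T L s0 x0"
proof -
  have eq: "x' t = x t" if "t \<in> {0..s1}" for t using x' that by (auto simp: X_set_def)
  have s0T: "s0 < T" using s by simp
  obtain R \<Lambda> where \<Lambda>: "0 \<le> \<Lambda>"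
    "\<And>s t. s \<in> {s0..T} \<Longrightarrow> t \<in> {s0..T} \<Longrightarrow> norm (x t - x s) \<le> \<Lambda> * \<bar>t - s\<bar>"
    using X_set_bounded_lipschitz[OF L s(1) s0T, of x0] x by metis
  obtain R' \<Lambda>' where \<Lambda>': "0 \<le> \<Lambda>'"
    "\<And>s t. s \<in> {s1..T} \<Longrightarrow> t \<in> {s1..T} \<Longrightarrow> norm (x' t - x' s) \<le> \<Lambda>' * \<bar>t - s\<bar>"
    using X_set_bounded_lipschitz[OF L _ s(3), of x] x' s by (metis order_trans)
  define \<Lambda>m where "\<Lambda>m = \<Lambda> + \<Lambda>'"
  have *: "norm (x' t - x' r) \<le> \<Lambda>m * (t - r)" if rt: "s0 \<le> r" "r \<le> t" "t \<le> T" for r t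
  proof -
    consider "t \<le> s1" | "r \<ge> s1" | "r < s1" "s1 < t" by linarith
    then show ?thesis
    proof cases
      case 1
      then have "norm (x' t - x' r) \<le> \<Lambda> * (t - r)" using \<Lambda>(2)[of r t] eq[of t] eq[of r] rt s by auto
      also have "\<dots> \<le> \<Lambda>m * (t - r)" using rt \<Lambda>' by (intro mult_right_mono) (auto simp: \<Lambda>m_def)
      finally show ?thesis .
    next
      case 2
      then have "norm (x' t - x' r) \<le> \<Lambda>' * (t - r)" using \<Lambda>'(2)[of r t] rt s by auto
      also have "\<dots> \<le> \<Lambda>m * (t - r)" using rt \<Lambda> by (intro mult_right_mono) (auto simp: \<Lambda>m_def)
      finally show ?thesis .
    next
      case 3
      have "norm (x' s1 - x' r) \<le> \<Lambda> * (s1 - r)" using \<Lambda>(2)[of r s1] eq[of s1] eq[of r] rt 3 s by auto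
      also have "\<dots> \<le> \<Lambda>m * (s1 - r)" using 3 \<Lambda>' by (intro mult_right_mono) (auto simp: \<Lambda>m_def)
      finally have 1: "norm (x' s1 - x' r) \<le> \<Lambda>m * (s1 - r)" .
      have "norm (x' t - x' s1) \<le> \<Lambda>' * (t - s1)" using \<Lambda>'(2)[of s1 t] rt 3 s by auto
      also have "\<dots> \<le> \<Lambda>m * (t - s1)" using 3 \<Lambda> by (intro mult_right_mono) (auto simp: \<Lambda>m_def)
      finally have 2: "norm (x' t - x' s1) \<le> \<Lambda>m * (t - s1)" .
      have "norm (x' t - x' r) \<le> norm (x' t - x' s1) + norm (x' s1 - x' r)"
        using norm_triangle_ineq[of "x' t - x' s1" "x' s1 - x' r"] by simp
      also have "\<dots> \<le> \<Lambda>m * (t - r)" using 1 2 by (simp add: algebra_simps)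
      finally show ?thesis .
    qed
  qed
  have ac: "abs_continuous_on_Icc x' s0 T"
  proof (rule lipschitz_imp_abs_continuous[of \<Lambda>m])
    show "0 \<le> \<Lambda>m" using \<Lambda> \<Lambda>' by (simp add: \<Lambda>m_def)
    fix r t assume "r \<in> {s0..T}" "t \<in> {s0..T}"
    then show "norm (x' t - x' r) \<le> \<Lambda>m * \<bar>t - r\<bar>"
      using *[of r t] *[of t r] by (cases "r \<le> t") (auto simp: norm_minus_commute)
  qed
  have A: "AE t in lebesgue. t \<in> {s0<..<T} \<longrightarrow> x differentiable (at t) \<and>
        norm (vector_derivative x (at t)) \<le> L * (1 + running_sup x t)"
    using x by (simp add: X_set_def)
  have A': "AE t in lebesgue. t \<in> {s1<..<T} \<longrightarrow> x' differentiable (at t) \<and>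
        norm (vector_derivative x' (at t)) \<le> L * (1 + running_sup x' t)"
    using x' by (simp add: X_set_def)
  have S: "AE t in lebesgue. t \<noteq> s1"
    using AE_not_in[of "{s1}" lebesgue] by (simp add: negligible_iff_null_sets[symmetric])
  have "AE t in lebesgue. t \<in> {s0<..<T} \<longrightarrow> x' differentiable (at t) \<and>
        norm (vector_derivative x' (at t)) \<le> L * (1 + running_sup x' t)"
    using A A' S
  proof eventually_elim
    case (elim t)
    show ?case
    proof
      assume t: "t \<in> {s0<..<T}"
      show "x' differentiable (at t) \<and> norm (vector_derivative x' (at t)) \<le> L * (1 + running_sup x' t)"
      proof (cases "t < s1")
        case False
        then show ?thesis using elim t by auto
      next
        case True
        have d: "(x has_vector_derivative vector_derivative x (at t)) (at t)"
          using elim t by (simp add: vector_derivative_works)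
        have d': "(x' has_vector_derivative vector_derivative x (at t)) (at t)"
          by (rule has_vector_derivative_transform_within_open[OF d, of "{s0<..<s1}"])
            (use t True eq s in auto)
        have "running_sup x' t = running_sup x t" using eq True by (intro running_sup_cong) auto
        then show ?thesis using d' elim t vector_derivative_at[OF d']
          by (auto intro: differentiableI_vector)
      qed
    qed
  qed
  then show ?thesis using x x' ac eq s by (auto simp: X_set_def)
qed

section \<open>Compactness of the set of admissible paths\<close>

lemma norm_le_sup_dist:
  assumes "x \<in> \<Omega> T" "x' \<in> \<Omega> T" "r \<in> {0..T}"
  shows "norm (x r - x' r) \<le> sup_dist T x x'"
proof -
  obtain R R' where "\<And>t. t \<in> {0..T} \<Longrightarrow> norm (x t) \<le> R" "\<And>t. t \<in> {0..T} \<Longrightarrow> norm (x' t) \<le> R'"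
    using path_norm_bounded assms by metis
  then have "norm (x t - x' t) \<le> R + R'" if "t \<in> {0..T}" for t
    using that by (metis add_mono norm_triangle_ineq4 order_trans)
  then show ?thesis
    using norm_le_running_sup[of T "\<lambda>r. x r - x' r" "R + R'" r] assms(3)
    by (simp add: sup_dist_def running_sup_def)
qed

lemma sup_dist_le:
  assumes "0 \<le> T" "\<And>r. r \<in> {0..T} \<Longrightarrow> norm (x r - x' r) \<le> c"
  shows "sup_dist T x x' \<le> c"
  using running_sup_le[of T "\<lambda>r. x r - x' r" c] assms by (simp add: sup_dist_def running_sup_def)

lemma sup_dist_nonneg:
  assumes "0 \<le> T" "x \<in> \<Omega> T" "x' \<in> \<Omega> T"
  shows "0 \<le> sup_dist T x x'"
proof -
  have "norm (x 0 - x' 0) \<le> sup_dist T x x'" using assms by (intro norm_le_sup_dist) auto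
  then show ?thesis using norm_ge_zero order_trans by blast
qed

text \<open>
  The paths coincide up to \<open>s0\<close> and are equi-Lipschitz after it, so the theorem of Arzela and Ascoli
  applies. The limit is again a cadlag path and Lipschitz after \<open>s0\<close>, so semicontinuity can be used there.
\<close>

lemma X_set_relatively_compact:
  fixes xs :: "nat \<Rightarrow> real \<Rightarrow> real^'d"
  assumes L: "0 \<le> L" and s0: "0 \<le> s0" "s0 < T" and x0: "x0 \<in> \<Omega> T"
    and xs: "\<And>n. xs n \<in> \<X> T L s0 x0"
  shows "\<exists>k x \<Lambda>. strict_mono (k :: nat \<Rightarrow> nat) \<and> x \<in> \<Omega> T \<and>
    (\<lambda>n. sup_dist T x (xs (k n))) \<longlonglongrightarrow> 0 \<and> 0 \<le> \<Lambda> \<and>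
    (\<forall>s\<in>{s0..T}. \<forall>t\<in>{s0..T}. norm (x t - x s) \<le> \<Lambda> * \<bar>t - s\<bar>)"
proof -
  obtain R \<Lambda> where R: "0 \<le> R" "0 \<le> \<Lambda>"
    "\<And>x t. x \<in> \<X> T L s0 x0 \<Longrightarrow> t \<in> {0..T} \<Longrightarrow> norm (x t) \<le> R"
    "\<And>x s t. x \<in> \<X> T L s0 x0 \<Longrightarrow> s \<in> {s0..T} \<Longrightarrow> t \<in> {s0..T} \<Longrightarrow> norm (x t - x s) \<le> \<Lambda> * \<bar>t - s\<bar>"
    using X_set_bounded_lipschitz[OF L s0] by metis
  obtain g k where g: "continuous_on {s0..T} g" and k: "strict_mono (k :: nat \<Rightarrow> nat)"
    and conv: "\<And>e. 0 < e \<Longrightarrow> \<exists>N. \<forall>n t. n \<ge> N \<and> t \<in> {s0..T} \<longrightarrow> norm (xs (k n) t - g t) < e"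
  proof (rule Arzela_Ascoli[of "{s0..T}" xs R])
    fix t e :: real assume t: "t \<in> {s0..T}" and e: "0 < e"
    show "\<exists>d. 0 < d \<and> (\<forall>n s. s \<in> {s0..T} \<and> norm (t - s) < d \<longrightarrow> norm (xs n t - xs n s) < e)"
    proof (intro exI[of _ "e / (\<Lambda> + 1)"] conjI allI impI)
      show "0 < e / (\<Lambda> + 1)" using e R by simp
      fix n s assume s: "s \<in> {s0..T} \<and> norm (t - s) < e / (\<Lambda> + 1)"
      have "norm (xs n t - xs n s) \<le> \<Lambda> * \<bar>t - s\<bar>" using R(4)[OF xs] s t by blast
      also have "\<dots> \<le> \<Lambda> * (e / (\<Lambda> + 1))" using s R by (intro mult_left_mono) auto
      also have "\<dots> < e" using R e by (simp add: field_simps)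
      finally show "norm (xs n t - xs n s) < e" .
    qed
  qed (use R(3)[OF xs] s0 in auto)
  define x where "x t = (if t < s0 then x0 t else if t \<le> T then g t else undefined)" for t
  have xg: "x t = g t" if "t \<in> {s0..T}" for t using that by (simp add: x_def)
  have unif: "\<exists>N. \<forall>n\<ge>N. \<forall>t\<in>{0..T}. norm (x t - xs (k n) t) \<le> e" if e: "e > 0" for e
  proof -
    obtain N where N: "\<And>n t. n \<ge> N \<Longrightarrow> t \<in> {s0..T} \<Longrightarrow> norm (xs (k n) t - g t) < e"
      using conv[OF e] by blast
    have "norm (x t - xs (k n) t) \<le> e" if n: "n \<ge> N" and t: "t \<in> {0..T}" for n t
    proof (cases "t < s0")
      case True
      then have "xs (k n) t = x0 t" using xs[of "k n"] t by (auto simp: X_set_def)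
      then show ?thesis using True e by (simp add: x_def)
    next
      case False
      then show ?thesis using N[OF n, of t] xg[of t] t by (simp add: norm_minus_commute)
    qed
    then show ?thesis by blast
  qed
  have pointwise: "(\<lambda>n. xs (k n) t) \<longlonglongrightarrow> x t" if t: "t \<in> {0..T}" for t
  proof (rule LIMSEQ_I)
    fix e :: real assume "e > 0"
    then obtain N where "\<forall>n\<ge>N. \<forall>t\<in>{0..T}. norm (x t - xs (k n) t) \<le> e / 2"
      using unif[of "e/2"] by auto
    then show "\<exists>N. \<forall>n\<ge>N. norm (xs (k n) t - x t) < e"
      using t \<open>e > 0\<close> by (intro exI[of _ N]) (force simp: norm_minus_commute)
  qed
  have lip: "norm (x t - x s) \<le> \<Lambda> * \<bar>t - s\<bar>" if "s \<in> {s0..T}" "t \<in> {s0..T}" for s t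
  proof (rule LIMSEQ_le_const2)
    show "(\<lambda>n. norm (xs (k n) t - xs (k n) s)) \<longlonglongrightarrow> norm (x t - x s)"
      using that s0 by (intro tendsto_norm tendsto_diff pointwise) auto
    show "\<exists>N. \<forall>n\<ge>N. norm (xs (k n) t - xs (k n) s) \<le> \<Lambda> * \<bar>t - s\<bar>"
      using R(4)[OF xs that] by blast
  qed
  have x_s0: "x t = x0 t" if "t \<in> {0..s0}" for t
  proof -
    have "xs (k n) t = x0 t" for n using xs[of "k n"] that by (auto simp: X_set_def)
    then have "(\<lambda>n. xs (k n) t) \<longlonglongrightarrow> x0 t" by simp
    then show ?thesis using pointwise[of t] that s0 LIMSEQ_unique by auto
  qed
  have x\<Omega>: "x \<in> \<Omega> T"
    unfolding cadlag_paths_def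
  proof (intro CollectI conjI ballI)
    show "x \<in> extensional {0..T}"
      using x0 s0 by (auto simp: x_def extensional_def cadlag_paths_def)
  next
    fix t assume t: "t \<in> {0..<T}"
    show "(x \<longlongrightarrow> x t) (at_right t)"
    proof (cases "t < s0")
      case True
      have "(x0 \<longlongrightarrow> x0 t) (at_right t)" using x0 t by (auto simp: cadlag_paths_def)
      moreover have "eventually (\<lambda>s. x0 s = x s) (at_right t)"
        using True by (auto simp: eventually_at_right_field x_def intro!: exI[of _ s0])
      ultimately show ?thesis using True t s0 x_s0[of t] by (auto elim: Lim_transform_eventually)
    next
      case False
      have "(g \<longlongrightarrow> g t) (at t within {s0..T})"
        using g False t by (auto simp: continuous_on_def)
      then have "(g \<longlongrightarrow> g t) (at t within {t..T})"
        by (rule tendsto_within_subset) (use False in auto)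
      then have "(g \<longlongrightarrow> g t) (at_right t)"
        using t by (simp add: at_within_Icc_at_right)
      moreover have "eventually (\<lambda>s. g s = x s) (at_right t)"
        using False t by (auto simp: eventually_at_right_field x_def intro!: exI[of _ T])
      ultimately show ?thesis using False t xg[of t] by (auto elim: Lim_transform_eventually)
    qed
  next
    fix t assume t: "t \<in> {0<..T}"
    show "\<exists>l. (x \<longlongrightarrow> l) (at_left t)"
    proof (cases "t \<le> s0")
      case True
      obtain l where "(x0 \<longlongrightarrow> l) (at_left t)" using x0 t unfolding cadlag_paths_def by blast
      moreover have "eventually (\<lambda>s. x0 s = x s) (at_left t)"
        using True by (auto simp: eventually_at_left_field x_def intro!: exI[of _ "t - 1"])
      ultimately show ?thesis by (auto elim: Lim_transform_eventually)
    next
      case False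
      have "(g \<longlongrightarrow> g t) (at t within {s0..T})"
        using g False t by (auto simp: continuous_on_def)
      then have "(g \<longlongrightarrow> g t) (at t within {s0..t})"
        by (rule tendsto_within_subset) (use t in auto)
      then have "(g \<longlongrightarrow> g t) (at_left t)"
        using False by (simp add: at_within_Icc_at_left)
      moreover have "eventually (\<lambda>s. g s = x s) (at_left t)"
        using False t by (auto simp: eventually_at_left_field x_def intro!: exI[of _ s0])
      ultimately show ?thesis by (auto elim: Lim_transform_eventually)
    qed
  qed
  have xs\<Omega>: "xs n \<in> \<Omega> T" for n using xs[of n] by (simp add: X_set_def)
  have "(\<lambda>n. sup_dist T x (xs (k n))) \<longlonglongrightarrow> 0"
  proof (rule LIMSEQ_I)
    fix e :: real assume e: "e > 0"
    then obtain N where N: "\<forall>n\<ge>N. \<forall>t\<in>{0..T}. norm (x t - xs (k n) t) \<le> e / 2"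
      using unif[of "e/2"] by auto
    have "norm (sup_dist T x (xs (k n)) - 0) < e" if "n \<ge> N" for n
    proof -
      have "sup_dist T x (xs (k n)) \<le> e / 2" using N that s0 by (intro sup_dist_le) auto
      then show ?thesis using sup_dist_nonneg[OF _ x\<Omega> xs\<Omega>[of "k n"]] s0 e by auto
    qed
    then show "\<exists>N. \<forall>n\<ge>N. norm (sup_dist T x (xs (k n)) - 0) < e" by blast
  qed
  then show ?thesis using k x\<Omega> R(2) lip by blast
qed

text \<open>
  For a path that is Lipschitz after \<open>s0\<close>, convergence of the times together with uniform
  convergence of the paths implies convergence for the pseudo-metric.
\<close>

lemma d_infty_le:
  assumes T: "0 \<le> s0" "s0 < T" and x: "x \<in> \<Omega> T" and x': "x' \<in> \<Omega> T"
    and \<Lambda>: "0 \<le> \<Lambda>"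
      "\<And>s t. s \<in> {s0..T} \<Longrightarrow> t \<in> {s0..T} \<Longrightarrow> norm (x t - x s) \<le> \<Lambda> * \<bar>t - s\<bar>"
    and t: "t \<in> {s0..T}" "t' \<in> {s0..T}"
  shows "d_infty T t x t' x' \<le> (1 + \<Lambda>) * \<bar>t - t'\<bar> + sup_dist T x x'"
proof -
  have "(SUP r\<in>{0..T}. norm (x (min r t) - x' (min r t'))) \<le> \<Lambda> * \<bar>t - t'\<bar> + sup_dist T x x'"
  proof (rule cSUP_least)
    fix r assume r: "r \<in> {0..T}"
    have 1: "norm (x (min r t) - x (min r t')) \<le> \<Lambda> * \<bar>t - t'\<bar>"
    proof (cases "r \<le> s0")
      case True
      then show ?thesis using t \<Lambda> by simp
    next
      case False
      then have "norm (x (min r t) - x (min r t')) \<le> \<Lambda> * \<bar>min r t - min r t'\<bar>"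
        using t r by (intro \<Lambda>(2)) auto
      also have "\<dots> \<le> \<Lambda> * \<bar>t - t'\<bar>" using \<Lambda>(1) by (intro mult_left_mono) auto
      finally show ?thesis .
    qed
    have 2: "norm (x (min r t') - x' (min r t')) \<le> sup_dist T x x'"
      using r t T by (intro norm_le_sup_dist x x') auto
    have "norm (x (min r t) - x' (min r t')) \<le>
        norm (x (min r t) - x (min r t')) + norm (x (min r t') - x' (min r t'))"
      using norm_triangle_ineq[of "x (min r t) - x (min r t')" "x (min r t') - x' (min r t')"] by simp
    then show "norm (x (min r t) - x' (min r t')) \<le> \<Lambda> * \<bar>t - t'\<bar> + sup_dist T x x'"
      using 1 2 by linarith
  qed (use T in auto)
  then show ?thesis unfolding d_infty_def by (simp add: algebra_simps)
qed

text \<open>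
  An upper semicontinuous function is bounded above on a relatively compact set. Together with
  its mirror image for lower semicontinuous functions, this bounds the values of those
  characteristics that stay between the two semisolutions.
\<close>

lemma USC_bounded_above:
  assumes L: "0 \<le> L" and s0: "0 \<le> s0" "s0 < T" and x0: "x0 \<in> \<Omega> T" and u: "USC T u"
  shows "\<exists>B. \<forall>t\<in>{s0..T}. \<forall>x\<in>\<X> T L s0 x0. u t x \<le> B"
proof (rule ccontr)
  assume "\<not> ?thesis"
  then have "\<exists>t x. t \<in> {s0..T} \<and> x \<in> \<X> T L s0 x0 \<and> u t x > real n" for n
    by (meson not_le)
  then obtain ts xs where ts: "\<And>n. ts n \<in> {s0..T}" and xs: "\<And>n. xs n \<in> \<X> T L s0 x0"
    and big: "\<And>n. u (ts n) (xs n) > real n" by metis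
  obtain k x \<Lambda> where k: "strict_mono (k :: nat \<Rightarrow> nat)" and x: "x \<in> \<Omega> T"
    and conv: "(\<lambda>n. sup_dist T x (xs (k n))) \<longlonglongrightarrow> 0" and \<Lambda>: "0 \<le> \<Lambda>"
    "\<And>s t. s \<in> {s0..T} \<Longrightarrow> t \<in> {s0..T} \<Longrightarrow> norm (x t - x s) \<le> \<Lambda> * \<bar>t - s\<bar>"
    using X_set_relatively_compact[of L s0 T x0 xs, OF L s0 x0 xs] by blast
  have "\<forall>n. (ts \<circ> k) n \<in> {s0..T}" using ts by simp
  then obtain t j where t: "t \<in> {s0..T}" and j: "strict_mono (j :: nat \<Rightarrow> nat)"
    and tconv: "(ts \<circ> k \<circ> j) \<longlonglongrightarrow> t"
    using compact_Icc[of s0 T, unfolded compact_def] by blast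
  have conv': "(\<lambda>n. sup_dist T x (xs (k (j n)))) \<longlonglongrightarrow> 0"
    using LIMSEQ_subseq_LIMSEQ[OF conv j] by (simp add: o_def)
  have lim: "(\<lambda>n. (1 + \<Lambda>) * \<bar>t - ts (k (j n))\<bar> + sup_dist T x (xs (k (j n)))) \<longlonglongrightarrow> 0"
    using tconv by (auto intro!: tendsto_eq_intros conv' simp: o_def)
  have "\<forall>\<epsilon>>0. \<exists>\<delta>>0. \<forall>s\<in>{0..T}. \<forall>x'\<in>\<Omega> T. d_infty T t x s x' < \<delta> \<longrightarrow> u s x' < u t x + \<epsilon>"
    using u x t s0 unfolding USC_def by auto
  then obtain \<delta> where \<delta>: "\<delta> > 0"
    "\<And>s x'. s \<in> {0..T} \<Longrightarrow> x' \<in> \<Omega> T \<Longrightarrow> d_infty T t x s x' < \<delta> \<Longrightarrow> u s x' < u t x + 1"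
    using zero_less_one by blast
  have "eventually (\<lambda>n. (1 + \<Lambda>) * \<bar>t - ts (k (j n))\<bar> + sup_dist T x (xs (k (j n))) < \<delta>) sequentially"
    using order_tendstoD(2)[OF lim \<delta>(1)] .
  moreover have "eventually (\<lambda>n. n \<ge> nat \<lceil>u t x + 1\<rceil>) sequentially"
    by (rule eventually_ge_at_top)
  ultimately have "eventually (\<lambda>n. False) sequentially"
  proof eventually_elim
    case (elim n)
    have x': "xs (k (j n)) \<in> \<Omega> T" using xs by (simp add: X_set_def)
    have "d_infty T t x (ts (k (j n))) (xs (k (j n))) < \<delta>"
      using d_infty_le[OF s0 x x' \<Lambda> t ts[of "k (j n)"]] elim by linarith
    then have "u (ts (k (j n))) (xs (k (j n))) < u t x + 1"
      using ts[of "k (j n)"] s0 by (intro \<delta>(2) x') auto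
    moreover have "n \<le> k (j n)" using k j
      by (metis comp_apply seq_suble strict_mono_o)
    ultimately show False using big[of "k (j n)"] elim by linarith
  qed
  then show False by simp
qed

text \<open>
  The paths of the two characteristics are compared at time \<open>T\<close> with no control over where they
  end up, so continuity of \<open>h\<close> has to be uniform on the set of admissible paths.
\<close>

lemma terminal_cost_uniformly_continuous:
  assumes L: "0 \<le> L" and s0: "0 \<le> s0" "s0 < T" and x0: "x0 \<in> \<Omega> T"
    and h: "continuous_terminal_cost T h" and \<epsilon>: "\<epsilon> > 0"
  shows "\<exists>r>0. \<forall>x\<in>\<X> T L s0 x0. \<forall>x'\<in>\<X> T L s0 x0. sup_dist T x x' < r \<longrightarrow> \<bar>h x - h x'\<bar> < \<epsilon>"
proof (rule ccontr)
  assume "\<not> ?thesis"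
  then have neg: "\<forall>r>0. \<exists>x\<in>\<X> T L s0 x0. \<exists>x'\<in>\<X> T L s0 x0. sup_dist T x x' < r \<and> \<bar>h x - h x'\<bar> \<ge> \<epsilon>"
    by (meson not_less)
  have "\<exists>x x'. x \<in> \<X> T L s0 x0 \<and> x' \<in> \<X> T L s0 x0 \<and> sup_dist T x x' < 1 / (real n + 1) \<and>
      \<bar>h x - h x'\<bar> \<ge> \<epsilon>" for n
    using neg[rule_format, of "1 / (real n + 1)"] by fastforce
  then obtain xs xs' where xs: "\<And>n. xs n \<in> \<X> T L s0 x0" and xs': "\<And>n. xs' n \<in> \<X> T L s0 x0"
    and close: "\<And>n. sup_dist T (xs n) (xs' n) < 1 / (real n + 1)"
    and far: "\<And>n. \<bar>h (xs n) - h (xs' n)\<bar> \<ge> \<epsilon>" by metis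
  obtain k x where k: "strict_mono (k :: nat \<Rightarrow> nat)" and x: "x \<in> \<Omega> T"
    and conv: "(\<lambda>n. sup_dist T x (xs (k n))) \<longlonglongrightarrow> 0"
    using X_set_relatively_compact[of L s0 T x0 xs, OF L s0 x0 xs] by blast
  have \<Omega>: "xs n \<in> \<Omega> T" "xs' n \<in> \<Omega> T" for n using xs[of n] xs'[of n] by (auto simp: X_set_def)
  obtain \<delta> where \<delta>: "\<delta> > 0" "\<And>x'. x' \<in> \<Omega> T \<Longrightarrow> sup_dist T x x' < \<delta> \<Longrightarrow> \<bar>h x' - h x\<bar> < \<epsilon> / 2"
    using h[unfolded continuous_terminal_cost_def, rule_format, OF x half_gt_zero[OF \<epsilon>]] by blast
  have "(\<lambda>n. 1 / (real (k n) + 1)) \<longlonglongrightarrow> 0"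
    using LIMSEQ_subseq_LIMSEQ[OF LIMSEQ_inverse_real_of_nat k] by (simp add: o_def inverse_eq_divide add.commute)
  then have lim: "(\<lambda>n. sup_dist T x (xs (k n)) + 1 / (real (k n) + 1)) \<longlonglongrightarrow> 0"
    using tendsto_add[OF conv] by force
  obtain n where n: "sup_dist T x (xs (k n)) + 1 / (real (k n) + 1) < \<delta>"
    using order_tendstoD(2)[OF lim \<delta>(1)] by (auto simp: eventually_sequentially)
  have "0 < 1 / (real (k n) + 1)" by simp
  then have "\<bar>h (xs (k n)) - h x\<bar> < \<epsilon> / 2" using n by (intro \<delta>(2) \<Omega>) linarith
  moreover have "sup_dist T x (xs' (k n)) \<le> sup_dist T x (xs (k n)) + sup_dist T (xs (k n)) (xs' (k n))"
  proof (rule sup_dist_le)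
    fix r assume r: "r \<in> {0..T}"
    have "norm (x r - xs' (k n) r) \<le> norm (x r - xs (k n) r) + norm (xs (k n) r - xs' (k n) r)"
      using norm_triangle_ineq[of "x r - xs (k n) r" "xs (k n) r - xs' (k n) r"] by simp
    then show "norm (x r - xs' (k n) r) \<le> sup_dist T x (xs (k n)) + sup_dist T (xs (k n)) (xs' (k n))"
      using norm_le_sup_dist[OF x \<Omega>(1)[of "k n"] r] norm_le_sup_dist[OF \<Omega>(1)[of "k n"] \<Omega>(2)[of "k n"] r]
      by linarith
  qed (use s0 in simp)
  then have "\<bar>h (xs' (k n)) - h x\<bar> < \<epsilon> / 2"
    using n close[of "k n"] by (intro \<delta>(2) \<Omega>) linarith
  ultimately show False using far[of "k n"] by linarith
qed

section \<open>Two characteristics on a short time interval\<close>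

text \<open>
  In the Lipschitz condition in \<open>x\<close> the exceptional null set depends on \<open>y\<close>, whereas along a
  characteristic \<open>y\<close> varies with \<open>t\<close>. The null sets for rational \<open>y\<close> have a null union, and continuity
  of \<open>H\<close> extends the inequality to all \<open>y\<close>.
\<close>

lemma hamiltonian_lipschitz_x_AE:
  fixes H :: "real \<Rightarrow> (real \<Rightarrow> real^'d) \<Rightarrow> real \<Rightarrow> real^'d \<Rightarrow> real"
  assumes "hamiltonian T H" and s0: "0 \<le> s0" "s0 < T" and x: "x \<in> \<Omega> T" "x' \<in> \<Omega> T"
    and M: "\<And>y. AE t\<in>{s0<..<T} in lebesgue.
        \<bar>H t x y z - H t x' y z\<bar> \<le> M * (1 + \<bar>y\<bar> + norm z) * running_sup (\<lambda>s. x s - x' s) t"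
  shows "AE t\<in>{s0<..<T} in lebesgue. \<forall>y.
        \<bar>H t x y z - H t x' y z\<bar> \<le> M * (1 + \<bar>y\<bar> + norm z) * running_sup (\<lambda>s. x s - x' s) t"
proof -
  interpret hamiltonian T H by fact
  have "AE t in lebesgue. \<forall>y\<in>\<rat>. t \<in> {s0<..<T} \<longrightarrow>
        \<bar>H t x y z - H t x' y z\<bar> \<le> M * (1 + \<bar>y\<bar> + norm z) * running_sup (\<lambda>s. x s - x' s) t"
    by (rule AE_ball_countable'[OF _ countable_rat]) (rule M)
  then show ?thesis using continuous
  proof eventually_elim
    case (elim t)
    show ?case
    proof (intro impI allI)
      fix y :: real assume t: "t \<in> {s0<..<T}"
      have cont: "\<exists>\<delta>>0. \<forall>y'. \<bar>y' - y\<bar> < \<delta> \<longrightarrow> \<bar>H t p y' z - H t p y z\<bar> < \<epsilon>"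
        if p: "p \<in> \<Omega> T" and e: "\<epsilon> > 0" for p y \<epsilon>
      proof -
        have "t \<in> {0<..<T}" using t s0 by auto
        then obtain \<delta> where \<delta>: "\<delta> > 0" "\<forall>x'\<in>\<Omega> T. \<forall>y' z'.
            sup_dist T p x' < \<delta> \<and> \<bar>y' - y\<bar> < \<delta> \<and> norm (z' - z) < \<delta> \<longrightarrow>
            \<bar>H t x' y' z' - H t p y z\<bar> < \<epsilon>"
          using elim(2) p e by blast
        have "sup_dist T p p = 0" using s0 by (simp add: sup_dist_def)
        then show ?thesis using \<delta> p by (intro exI[of _ \<delta>]) auto
      qed
      have isC: "continuous_on UNIV (\<lambda>y. H t p y z)" if "p \<in> \<Omega> T" for p
        unfolding continuous_on_iff dist_real_def using cont[OF that] by auto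
      define G where "G y = M * (1 + \<bar>y\<bar> + norm z) * running_sup (\<lambda>s. x s - x' s) t - \<bar>H t x y z - H t x' y z\<bar>" for y
      have "continuous_on UNIV G"
        unfolding G_def by (intro continuous_intros isC x)
      moreover have "0 \<le> G q" if "q \<in> \<rat>" for q using elim(1) t that by (simp add: G_def)
      ultimately have "0 \<le> G y"
        using continuous_ge_on_closure[of "\<rat>" G y 0] by (simp add: Rats_closure_real)
      then show "\<bar>H t x y z - H t x' y z\<bar> \<le> M * (1 + \<bar>y\<bar> + norm z) * running_sup (\<lambda>s. x s - x' s) t"
        by (simp add: G_def)
    qed
  qed
qed

text \<open>
  Two characteristics with the same driving vector \<open>z\<close>. As long as \<open>y' \<le> y\<close>, monotonicity gives
  \<open>H t x y z - H t x' y' z \<le> H t x y' z - H t x' y' z\<close>, and the Lipschitz condition in \<open>x\<close> bounds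
  the right-hand side. The terms with the derivatives of the paths integrate exactly.
\<close>

lemma Y_set_gap_lower_bound:
  fixes H :: "real \<Rightarrow> (real \<Rightarrow> real^'d) \<Rightarrow> real \<Rightarrow> real^'d \<Rightarrow> real"
  assumes H: "hamiltonian T H" and a: "0 \<le> a" "a \<le> b" "b \<le> T" "a < T"
    and xy: "(x, y) \<in> \<Y> T H L a xa ya z" and xy': "(x', y') \<in> \<Y> T H L a xa' ya' z"
    and M: "0 \<le> M" "\<And>y. AE t\<in>{a<..<T} in lebesgue.
        \<bar>H t x y z - H t x' y z\<bar> \<le> M * (1 + \<bar>y\<bar> + norm z) * running_sup (\<lambda>s. x s - x' s) t"
    and order: "\<And>t. t \<in> {a<..<b} \<Longrightarrow> y' t \<le> y t" and B: "\<And>t. t \<in> {a<..<b} \<Longrightarrow> \<bar>y' t\<bar> \<le> B"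
    and B0: "0 \<le> B"
  defines "w \<equiv> \<lambda>t. x t - x' t"
  shows "y b - y' b \<ge> ya - ya' + z \<bullet> (w b - w a) - M * (1 + B + norm z) * running_sup w b * (b - a)"
proof -
  interpret hamiltonian T H by (rule H)
  have X: "x \<in> \<X> T L a xa" "x' \<in> \<X> T L a xa'" using xy xy' by (auto simp: Y_set_def)
  have \<Omega>: "x \<in> \<Omega> T" "x' \<in> \<Omega> T" using X by (auto simp: X_set_def)
  define I where "I t = vector_derivative x (at t) \<bullet> z - H t x (y t) z" for t
  define I' where "I' t = vector_derivative x' (at t) \<bullet> z - H t x' (y' t) z" for t
  have I: "(I has_integral (y b - ya)) {a..b}"
  proof -
    have "set_integrable lebesgue {a..T} I" using xy by (simp add: Y_set_def I_def[abs_def])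
    then have "set_integrable lebesgue {a..b} I"
      using a by (elim set_integrable_subset) auto
    moreover have "y b = ya + (LINT s:{a..b}|lebesgue. I s)" using xy a by (simp add: Y_set_def I_def)
    ultimately show ?thesis using has_integral_set_lebesgue by fastforce
  qed
  have I': "(I' has_integral (y' b - ya')) {a..b}"
  proof -
    have "set_integrable lebesgue {a..T} I'" using xy' by (simp add: Y_set_def I'_def[abs_def])
    then have "set_integrable lebesgue {a..b} I'"
      using a by (elim set_integrable_subset) auto
    moreover have "y' b = ya' + (LINT s:{a..b}|lebesgue. I' s)" using xy' a by (simp add: Y_set_def I'_def)
    ultimately show ?thesis using has_integral_set_lebesgue by fastforce
  qed
  define c where "c = M * (1 + B + norm z) * running_sup w b"
  define J where "J t = (vector_derivative x (at t) - vector_derivative x' (at t)) \<bullet> z - c" for t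
  have "((\<lambda>t. vector_derivative x (at t) - vector_derivative x' (at t)) has_integral
      ((x b - x a) - (x' b - x' a))) {a..b}"
    by (intro has_integral_diff X_set_has_integral[OF X(1)] X_set_has_integral[OF X(2)]) (use a in auto)
  from has_integral_linear[OF this bounded_linear_inner_left[of z]]
  have "((\<lambda>t. (vector_derivative x (at t) - vector_derivative x' (at t)) \<bullet> z) has_integral
      (w b - w a) \<bullet> z) {a..b}" by (simp add: w_def o_def algebra_simps)
  moreover have "((\<lambda>t. c) has_integral (c * (b - a))) {a..b}"
    using has_integral_const_real[of c a b] a by (simp add: mult.commute)
  ultimately have J: "(J has_integral ((w b - w a) \<bullet> z - c * (b - a))) {a..b}"
    unfolding J_def by (rule has_integral_diff)
  obtain R R' where "\<And>t. t \<in> {0..T} \<Longrightarrow> norm (x t) \<le> R" "\<And>t. t \<in> {0..T} \<Longrightarrow> norm (x' t) \<le> R'"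
    using path_norm_bounded \<Omega> by metis
  then have wR: "norm (w t) \<le> R + R'" if "t \<in> {0..T}" for t
    using that unfolding w_def by (metis add_mono norm_triangle_ineq4 order_trans)
  have "AE t in lebesgue. t \<in> {a<..<b} \<longrightarrow> J t \<le> I t - I' t"
    using hamiltonian_lipschitz_x_AE[OF H a(1,4) \<Omega> M(2)] non_increasing
  proof eventually_elim
    case (elim t)
    show ?case
    proof
      assume t: "t \<in> {a<..<b}"
      have ta: "t \<in> {a<..<T}" "t \<in> {0<..<T}" using t a by auto
      have "antimono (\<lambda>y. H t x y z)" using elim ta \<Omega> by blast
      then have "H t x (y t) z \<le> H t x (y' t) z" using order[OF t] by (auto dest: antimonoD)
      also have "\<dots> \<le> H t x' (y' t) z + M * (1 + \<bar>y' t\<bar> + norm z) * running_sup w t"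
      proof -
        have "\<bar>H t x (y' t) z - H t x' (y' t) z\<bar> \<le> M * (1 + \<bar>y' t\<bar> + norm z) * running_sup w t"
          using elim(1) ta(1) unfolding w_def by blast
        then show ?thesis by linarith
      qed
      also have "M * (1 + \<bar>y' t\<bar> + norm z) * running_sup w t \<le> c"
        unfolding c_def
      proof (intro mult_mono mult_left_mono M(1))
        show "1 + \<bar>y' t\<bar> + norm z \<le> 1 + B + norm z" using B[OF t] by simp
        show "running_sup w t \<le> running_sup w b"
          using t a wR by (intro running_sup_mono[where R="R + R'"]) auto
        show "0 \<le> running_sup w t" using t a wR by (intro running_sup_nonneg[where R="R + R'"]) auto
      qed (use M B0 in auto)
      finally show "J t \<le> I t - I' t" by (simp add: J_def I_def I'_def inner_diff_left)
    qed
  qed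
  then obtain N where N: "negligible N" "\<And>t. t \<notin> N \<Longrightarrow> t \<in> {a<..<b} \<longrightarrow> J t \<le> I t - I' t"
    using AE_lebesgue_negligible by blast
  define N' where "N' = N \<union> {a, b}"
  have N': "negligible N'" unfolding N'_def using N(1) by (auto intro: negligible_Un)
  have "((\<lambda>t. if t \<in> N' then I t - I' t else J t) has_integral ((w b - w a) \<bullet> z - c * (b - a))) {a..b}"
    by (rule has_integral_spike[OF N' _ J]) auto
  then have "(w b - w a) \<bullet> z - c * (b - a) \<le> (y b - ya) - (y' b - ya')"
    by (rule has_integral_le[OF _ has_integral_diff[OF I I']]) (use N in \<open>auto simp: N'_def\<close>)
  then show ?thesis unfolding c_def by (simp add: inner_commute algebra_simps)
qed

text \<open>
  The previous bound requires \<open>y' \<le> y\<close>, and also yields it on a short interval: up to the first time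
  at which \<open>y \<le> y'\<close> the gap has not lost more than a multiple of the length of the interval.
\<close>

lemma Y_set_order_preserved:
  fixes H :: "real \<Rightarrow> (real \<Rightarrow> real^'d) \<Rightarrow> real \<Rightarrow> real^'d \<Rightarrow> real"
  assumes H: "hamiltonian T H" and a: "0 \<le> a" "a \<le> b" "b \<le> T" "a < T"
    and xy: "(x, y) \<in> \<Y> T H L a xa ya z" and xy': "(x', y') \<in> \<Y> T H L a xa' ya' z"
    and M: "0 \<le> M" "\<And>y. AE t\<in>{a<..<T} in lebesgue.
        \<bar>H t x y z - H t x' y z\<bar> \<le> M * (1 + \<bar>y\<bar> + norm z) * running_sup (\<lambda>s. x s - x' s) t"
    and B: "\<And>t. t \<in> {a..b} \<Longrightarrow> y' t \<le> y t \<Longrightarrow> \<bar>y' t\<bar> \<le> B" and B0: "0 \<le> B"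
    and R: "\<And>t. t \<in> {0..b} \<Longrightarrow> norm (x t - x' t) \<le> R"
    and \<Lambda>: "\<And>t. t \<in> {a..b} \<Longrightarrow> norm ((x t - x' t) - (x a - x' a)) \<le> \<Lambda> * (t - a)" "0 \<le> \<Lambda>"
    and gap: "(norm z * \<Lambda> + M * (1 + B + norm z) * R) * (b - a) < ya - ya'"
    and s: "s \<in> {a..b}"
  shows "y' s < y s"
proof (rule ccontr)
  assume "\<not> y' s < y s"
  define w where "w t = x t - x' t" for t
  define S where "S = {t \<in> {a..b}. y t - y' t \<le> 0}"
  have cont: "continuous_on {a..b} y" "continuous_on {a..b} y'"
    using xy xy' a by (auto simp: Y_set_def intro: continuous_on_subset)
  have "compact S" unfolding S_def
  proof -
    have "closedin (top_of_set {a..b}) ({a..b} \<inter> (\<lambda>t. y t - y' t) -` {..0})"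
      by (intro continuous_closedin_preimage continuous_intros cont closed_atMost)
    moreover have "{t \<in> {a..b}. y t - y' t \<le> 0} = {a..b} \<inter> (\<lambda>t. y t - y' t) -` {..0}" by auto
    ultimately show "compact {t \<in> {a..b}. y t - y' t \<le> 0}"
      by (metis closedin_compact compact_Icc)
  qed
  moreover have "S \<noteq> {}" using s \<open>\<not> y' s < y s\<close> by (auto simp: S_def)
  ultimately obtain \<sigma> where \<sigma>: "\<sigma> \<in> S" "\<And>t. t \<in> S \<Longrightarrow> \<sigma> \<le> t"
    using compact_attains_inf by metis
  have ab: "a \<le> \<sigma>" "\<sigma> \<le> b" using \<sigma> by (auto simp: S_def)
  have before: "y' t \<le> y t" if "t \<in> {a<..<\<sigma>}" for t
    using \<sigma>(2)[of t] that ab unfolding S_def by force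
  have rs: "running_sup w \<sigma> \<le> R" using ab a R by (intro running_sup_le) (auto simp: w_def)
  have R0: "0 \<le> R" using R[of b] a norm_ge_zero order_trans by (metis atLeastAtMost_iff order_refl)
  have "y \<sigma> - y' \<sigma> \<ge> ya - ya' + z \<bullet> (w \<sigma> - w a) - M * (1 + B + norm z) * running_sup w \<sigma> * (\<sigma> - a)"
    unfolding w_def
    using before ab a B by (intro Y_set_gap_lower_bound[OF H _ _ _ _ xy xy' M _ _ B0]) auto
  moreover have "M * (1 + B + norm z) * running_sup w \<sigma> * (\<sigma> - a) \<le> M * (1 + B + norm z) * R * (b - a)"
    using rs ab M B0 R0 by (intro mult_mono mult_left_mono) auto
  moreover have "- (norm z * \<Lambda> * (b - a)) \<le> z \<bullet> (w \<sigma> - w a)"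
  proof -
    have "\<bar>z \<bullet> (w \<sigma> - w a)\<bar> \<le> norm z * norm (w \<sigma> - w a)" by (rule Cauchy_Schwarz_ineq2)
    also have "\<dots> \<le> norm z * (\<Lambda> * (b - a))"
    proof (intro mult_left_mono)
      have "norm (w \<sigma> - w a) \<le> \<Lambda> * (\<sigma> - a)" unfolding w_def using ab by (intro \<Lambda>(1)) auto
      also have "\<dots> \<le> \<Lambda> * (b - a)" using ab \<Lambda>(2) by (intro mult_left_mono) auto
      finally show "norm (w \<sigma> - w a) \<le> \<Lambda> * (b - a)" .
    qed simp
    finally show ?thesis by (simp add: mult.assoc)
  qed
  ultimately have "y \<sigma> - y' \<sigma> > 0" using gap by (simp add: algebra_simps)
  then show False using \<sigma>(1) by (simp add: S_def)
qed

text \<open>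
  The gap \<open>y - y'\<close> minus a weighted gauge of the distance of the paths almost does not decrease.
  Since \<open>z\<close> is the weighted gradient of the gauge, the first-order terms in the increment of \<open>w\<close>
  cancel. There remains \<open>M (1 + B + \<bar>z\<bar>) m\<close>, which the decrease of the weight from \<open>c\<close> to \<open>c'\<close>
  compensates: \<open>\<bar>z\<bar> m \<le> 4 c m\<^sup>4\<close> and \<open>m \<le> \<eta> + c m\<^sup>4\<close>, while the gauge is at least \<open>m\<^sup>4 / 2\<close>. What is
  lost is of order \<open>\<eta>\<close> per unit of time, and of second order in the length of the interval.
\<close>

lemma Y_set_gauge_step:
  fixes H :: "real \<Rightarrow> (real \<Rightarrow> real^'d) \<Rightarrow> real \<Rightarrow> real^'d \<Rightarrow> real"
  assumes H: "hamiltonian T H" and a: "0 \<le> a" "a \<le> b" "b \<le> T" "a < T"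
    and xy: "(x, y) \<in> \<Y> T H L a xa ya z" and xy': "(x', y') \<in> \<Y> T H L a xa' ya' z"
    and M: "0 \<le> M" "\<And>y. AE t\<in>{a<..<T} in lebesgue.
        \<bar>H t x y z - H t x' y z\<bar> \<le> M * (1 + \<bar>y\<bar> + norm z) * running_sup (\<lambda>s. x s - x' s) t"
    and B: "\<And>t. t \<in> {a..b} \<Longrightarrow> y' t \<le> y t \<Longrightarrow> \<bar>y' t\<bar> \<le> B" and B0: "0 \<le> B"
    and R: "\<And>t. t \<in> {0..b} \<Longrightarrow> norm (x t - x' t) \<le> R"
    and \<Lambda>: "\<And>t. t \<in> {a..b} \<Longrightarrow> norm ((x t - x' t) - (x a - x' a)) \<le> \<Lambda> * (t - a)" "0 \<le> \<Lambda>"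
    and gap: "(norm z * \<Lambda> + M * (1 + B + norm z) * R) * (b - a) < ya - ya'"
    and z: "z = c *\<^sub>R path_gauge_grad (\<lambda>t. x t - x' t) a"
    and \<eta>: "\<eta> > 0" "1 \<le> c * \<eta> ^ 3"
    and c: "0 \<le> c" "2 * M * (5 + B) * c * (b - a) \<le> c - c'"
  defines "w \<equiv> \<lambda>t. x t - x' t"
  shows "ya - ya' - c * path_gauge w a - (M * (1 + B) * \<eta> * (b - a) + 28 * c * R\<^sup>2 * \<Lambda>\<^sup>2 * (b - a)\<^sup>2)
    \<le> y b - y' b - c' * path_gauge w b"
proof -
  define m where "m = running_sup w b"
  define \<tau> where "\<tau> = b - a"
  have \<tau>: "0 \<le> \<tau>" using a by (simp add: \<tau>_def)
  have wR: "norm (w t) \<le> R" if "t \<in> {0..b}" for t using R that by (simp add: w_def)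
  have m0: "0 \<le> m" unfolding m_def using a wR by (intro running_sup_nonneg[where R=R]) auto
  have order: "y' t \<le> y t" if "t \<in> {a..b}" for t
    using Y_set_order_preserved[OF H a xy xy' M B B0 R \<Lambda> gap that] by simp
  have D: "y b - y' b \<ge> ya - ya' + z \<bullet> (w b - w a) - M * (1 + B + norm z) * m * \<tau>"
    unfolding w_def m_def \<tau>_def
    using order B by (intro Y_set_gap_lower_bound[OF H a xy xy' M _ _ B0]) auto
  have "path_gauge w b \<le> path_gauge w a + path_gauge_grad w a \<bullet> (w b - w a) + 28 * R\<^sup>2 * (\<Lambda> * \<tau>)\<^sup>2"
  proof (rule path_gauge_step[OF a(1,2) wR])
    fix r assume r: "r \<in> {a..b}"
    have "norm (w r - w a) \<le> \<Lambda> * (r - a)" unfolding w_def by (rule \<Lambda>(1)[OF r])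
    also have "\<dots> \<le> \<Lambda> * \<tau>" using r \<Lambda>(2) by (intro mult_left_mono) (auto simp: \<tau>_def)
    finally show "norm (w r - w a) \<le> \<Lambda> * \<tau>" .
  qed
  then have "c * path_gauge w b \<le> c * (path_gauge w a + path_gauge_grad w a \<bullet> (w b - w a) + 28 * R\<^sup>2 * (\<Lambda> * \<tau>)\<^sup>2)"
    using c(1) by (rule mult_left_mono)
  then have V: "c * path_gauge w b \<le> c * path_gauge w a + z \<bullet> (w b - w a) + 28 * c * R\<^sup>2 * \<Lambda>\<^sup>2 * \<tau>\<^sup>2"
    unfolding z w_def[symmetric] by (simp add: algebra_simps)
  have "m ^ 4 / 2 \<le> path_gauge w b" unfolding m_def by (rule path_gauge_ge)
  moreover have "0 \<le> c - c'"
    by (rule order_trans[OF _ c(2)]) (use c(1) M(1) B0 a in simp)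
  ultimately have "(c - c') * (m ^ 4 / 2) \<le> (c - c') * path_gauge w b"
    by (rule mult_left_mono)
  moreover have "(2 * M * (5 + B) * c * \<tau>) * (m ^ 4 / 2) \<le> (c - c') * (m ^ 4 / 2)"
    using c(2) unfolding \<tau>_def by (intro mult_right_mono) auto
  ultimately have cc: "M * (5 + B) * c * \<tau> * m ^ 4 \<le> (c - c') * path_gauge w b"
    by (simp add: field_simps)
  have nz: "norm z \<le> c * (4 * m ^ 3)"
  proof -
    have "norm (path_gauge_grad w a) \<le> 4 * running_sup w a ^ 3"
      using a wR by (intro norm_path_gauge_grad_le[where R=R]) auto
    also have "\<dots> \<le> 4 * m ^ 3"
      unfolding m_def using a wR
      by (intro mult_left_mono power_mono running_sup_mono[where R=R] running_sup_nonneg[where R=R]) auto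
    finally show ?thesis unfolding z w_def[symmetric] using c(1) by (simp add: mult_left_mono)
  qed
  \<comment> \<open>Since \<open>c\<close> is at least \<open>\<eta>\<close> to the power \<open>-3\<close>, the quartic term dominates \<open>m\<close> once \<open>m > \<eta>\<close>.\<close>
  have m\<eta>: "m \<le> \<eta> + c * m ^ 4"
  proof (cases "m \<le> \<eta>")
    case True
    moreover have "0 \<le> c * m ^ 4" using c(1) m0 by simp
    ultimately show ?thesis by linarith
  next
    case False
    then have "\<eta> ^ 3 \<le> m ^ 3" using \<eta> by (intro power_mono) auto
    then have "c * \<eta> ^ 3 \<le> c * m ^ 3" using c(1) by (intro mult_left_mono)
    then have "1 * m \<le> c * m ^ 3 * m" using \<eta>(2) m0 by (intro mult_right_mono) auto
    then show ?thesis using \<eta>(1) by (simp add: power3_eq_cube power4_eq_xxxx mult.assoc)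
  qed
  have "(1 + B + norm z) * m \<le> (1 + B) * (\<eta> + c * m ^ 4) + c * (4 * m ^ 3) * m"
    using nz m\<eta> m0 B0 by (simp add: distrib_right add_mono mult_left_mono mult_right_mono)
  also have "\<dots> = (1 + B) * \<eta> + (5 + B) * c * m ^ 4"
    by (simp add: algebra_simps power3_eq_cube power4_eq_xxxx)
  finally have "M * \<tau> * ((1 + B + norm z) * m) \<le> M * \<tau> * ((1 + B) * \<eta> + (5 + B) * c * m ^ 4)"
    using M \<tau> by (intro mult_left_mono) auto
  then have "M * (1 + B + norm z) * m * \<tau> \<le> M * (1 + B) * \<eta> * \<tau> + M * (5 + B) * c * \<tau> * m ^ 4"
    by (simp add: algebra_simps)
  then show ?thesis using D V cc unfolding \<tau>_def[symmetric] by (simp add: algebra_simps)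
qed

section \<open>Comparison of semisolutions\<close>

lemma exp_minus_le_one_minus_half:
  fixes u :: real
  assumes "0 \<le> u" "u \<le> 1"
  shows "exp (- u) \<le> 1 - u / 2"
proof -
  have "1 \<le> (1 - u / 2) * (1 + u)"
    using mult_left_mono[OF assms(2,1)] by (simp add: algebra_simps)
  also have "\<dots> \<le> (1 - u / 2) * exp u"
    using assms exp_ge_add_one_self[of u] by (intro mult_left_mono) auto
  finally show ?thesis by (simp add: exp_minus field_simps)
qed

text \<open>
  The order of the choices is essential. The bounds \<open>R\<close>, \<open>\<Lambda>\<close>, \<open>M\<close>, \<open>B\<close> and the modulus \<open>r\<close> of \<open>h\<close>
  depend on the initial point only. Then \<open>\<eta>\<close> is chosen, so that the error of order \<open>\<eta>\<close> stays below
  \<open>\<delta> / 4\<close> and the final distance of the paths below \<open>r\<close>. The number \<open>N\<close> of grid intervals comes last,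
  since the constants \<open>C1\<close> and \<open>C2\<close> of the discretization blow up as \<open>\<eta>\<close> tends to \<open>0\<close>.
\<close>

lemma minimax_comparison_before_T:
  fixes h :: "(real \<Rightarrow> real^'d) \<Rightarrow> real"
    and H :: "real \<Rightarrow> (real \<Rightarrow> real^'d) \<Rightarrow> real \<Rightarrow> real^'d \<Rightarrow> real"
    and u v :: "real \<Rightarrow> (real \<Rightarrow> real^'d) \<Rightarrow> real"
  assumes h: "continuous_terminal_cost T h" and H: "hamiltonian T H" and L: "0 \<le> L"
    and u: "minimax_subsolution T H h L u" and v: "minimax_supersolution T H h L v"
    and s0: "0 \<le> s0" "s0 < T" and x0: "x0 \<in> \<Omega> T"
  shows "u s0 x0 \<le> v s0 x0"
proof (rule ccontr)
  assume "\<not> u s0 x0 \<le> v s0 x0"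
  define \<delta> where "\<delta> = u s0 x0 - v s0 x0"
  have \<delta>: "\<delta> > 0" using \<open>\<not> u s0 x0 \<le> v s0 x0\<close> by (simp add: \<delta>_def)
  interpret hamiltonian T H by (rule H)
  define X where "X = \<X> T L s0 x0"
  have X\<Omega>: "x \<in> \<Omega> T" if "x \<in> X" for x using that by (simp add: X_def X_set_def)
  obtain R0 \<Lambda>0 where R0: "0 \<le> R0" "0 \<le> \<Lambda>0" "\<And>x t. x \<in> X \<Longrightarrow> t \<in> {0..T} \<Longrightarrow> norm (x t) \<le> R0"
    "\<And>x s t. x \<in> X \<Longrightarrow> s \<in> {s0..T} \<Longrightarrow> t \<in> {s0..T} \<Longrightarrow> norm (x t - x s) \<le> \<Lambda>0 * \<bar>t - s\<bar>"
    using X_set_bounded_lipschitz[OF L s0, of x0] unfolding X_def by metis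
  define R \<Lambda> where "R = 2 * R0" and "\<Lambda> = 2 * \<Lambda>0"
  have R: "0 \<le> R" "0 \<le> \<Lambda>" using R0 by (auto simp: R_def \<Lambda>_def)
  have wR: "norm (x t - x' t) \<le> R" if "x \<in> X" "x' \<in> X" "t \<in> {0..T}" for x x' t
    using norm_triangle_ineq4[of "x t" "x' t"] R0(3)[OF that(1,3)] R0(3)[OF that(2,3)]
    by (simp add: R_def)
  have w\<Lambda>: "norm ((x t - x' t) - (x a - x' a)) \<le> \<Lambda> * (t - a)"
    if "x \<in> X" "x' \<in> X" "s0 \<le> a" "a \<le> t" "t \<le> T" for x x' a t
  proof -
    have "norm ((x t - x' t) - (x a - x' a)) \<le> norm (x t - x a) + norm (x' t - x' a)"
      using norm_triangle_ineq4[of "x t - x a" "x' t - x' a"] by (simp add: algebra_simps)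
    then show ?thesis
      using R0(4)[OF that(1), of a t] R0(4)[OF that(2), of a t] that by (simp add: \<Lambda>_def)
  qed
  obtain M where M0: "0 \<le> M" and M1: "\<forall>t0\<in>{0..<T}. \<forall>x0\<in>\<Omega> T. \<forall>x\<in>\<X> T L t0 x0. \<forall>x'\<in>\<X> T L t0 x0. \<forall>y z.
      AE t\<in>{t0<..<T} in lebesgue.
        \<bar>H t x y z - H t x' y z\<bar> \<le> M * (1 + \<bar>y\<bar> + norm z) * running_sup (\<lambda>s. x s - x' s) t"
    using lipschitz_x[rule_format, OF L] by blast
  have "s0 \<in> {0..<T}" using s0 by simp
  then have M: "0 \<le> M" "\<And>x x' y z. x \<in> X \<Longrightarrow> x' \<in> X \<Longrightarrow> AE t\<in>{s0<..<T} in lebesgue.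
        \<bar>H t x y z - H t x' y z\<bar> \<le> M * (1 + \<bar>y\<bar> + norm z) * running_sup (\<lambda>s. x s - x' s) t"
    using M0 M1[rule_format, OF _ x0] unfolding X_def by auto
  have "USC T u" using u by (simp add: minimax_subsolution_def)
  then obtain Bu where Bu: "\<And>t x. t \<in> {s0..T} \<Longrightarrow> x \<in> X \<Longrightarrow> u t x \<le> Bu"
    using USC_bounded_above[OF L s0 x0] unfolding X_def by blast
  have "USC T (\<lambda>t x. - v t x)"
  proof -
    have "LSC T v" using v by (simp add: minimax_supersolution_def)
    moreover have "- a < - b + e \<longleftrightarrow> a > b - e" for a b e :: real by linarith
    ultimately show ?thesis unfolding USC_def LSC_def by simp
  qed
  then obtain Bv where Bv: "\<And>t x. t \<in> {s0..T} \<Longrightarrow> x \<in> X \<Longrightarrow> - v t x \<le> Bv"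
    using USC_bounded_above[OF L s0 x0] unfolding X_def by blast
  define B where "B = max 0 (max Bu Bv)"
  have B: "0 \<le> B" "\<And>t x. t \<in> {s0..T} \<Longrightarrow> x \<in> X \<Longrightarrow> u t x \<le> B"
    "\<And>t x. t \<in> {s0..T} \<Longrightarrow> x \<in> X \<Longrightarrow> - B \<le> v t x"
    using Bu Bv by (force simp: B_def)+
  obtain r where r: "r > 0"
    "\<And>x x'. x \<in> X \<Longrightarrow> x' \<in> X \<Longrightarrow> sup_dist T x x' < r \<Longrightarrow> \<bar>h x - h x'\<bar> < \<delta> / 2"
    using terminal_cost_uniformly_continuous[OF L s0 x0 h half_gt_zero[OF \<delta>]] unfolding X_def by blast

  define \<kappa> where "\<kappa> = 2 * M * (5 + B)"
  have \<kappa>: "0 \<le> \<kappa>" using M B by (simp add: \<kappa>_def)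
  have MBT: "0 \<le> M * (1 + B) * T" using M(1) B(1) s0 by simp
  define \<eta> where "\<eta> = min 1 (min (\<delta> / (4 * (M * (1 + B) * T + 1))) (r ^ 4 / (4 * B + 1)))"
  have \<eta>: "0 < \<eta>" "\<eta> \<le> 1" "\<eta> \<le> \<delta> / (4 * (M * (1 + B) * T + 1))" "\<eta> \<le> r ^ 4 / (4 * B + 1)"
    using \<delta> r(1) B(1) MBT unfolding \<eta>_def
    by (auto intro!: divide_pos_pos add_nonneg_pos simp: min.coboundedI2)
  have \<eta>1: "M * (1 + B) * T * \<eta> \<le> \<delta> / 4"
  proof -
    have "M * (1 + B) * T * \<eta> \<le> (M * (1 + B) * T + 1) * \<eta>" using \<eta>(1) by (intro mult_right_mono) auto
    also have "\<dots> \<le> (M * (1 + B) * T + 1) * (\<delta> / (4 * (M * (1 + B) * T + 1)))"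
      using \<eta>(3) MBT by (intro mult_left_mono) auto
    also have "\<dots> = \<delta> / 4" using MBT by (simp add: field_simps)
    finally show ?thesis .
  qed
  have \<eta>2: "4 * B * \<eta> ^ 3 < r ^ 4"
  proof -
    have "\<eta> ^ 3 \<le> \<eta> ^ 1" using \<eta> by (intro power_decreasing) auto
    then have "4 * B * \<eta> ^ 3 \<le> 4 * B * \<eta>" using B(1) by (intro mult_left_mono) auto
    also have "\<dots> < (4 * B + 1) * \<eta>" using \<eta> by (simp add: distrib_right)
    also have "\<dots> \<le> r ^ 4" using \<eta>(4) B(1) by (simp add: field_simps)
    finally show ?thesis .
  qed

  \<comment> \<open>The exponential rate \<open>2 \<kappa>\<close> is twice the relative decrease that a step needs, because
    the decrease is estimated by \<open>exp (- u) \<le> 1 - u / 2\<close>.\<close>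
  define c where "c t = exp (2 * \<kappa> * (T - t)) / \<eta> ^ 3" for t
  define C where "C = exp (2 * \<kappa> * T) / \<eta> ^ 3"
  have cpos: "0 < c t" for t using \<eta> by (simp add: c_def)
  have cC: "c t \<le> C" if "0 \<le> t" for t
    unfolding c_def C_def using \<eta> \<kappa> that by (intro divide_right_mono) (auto simp: mult_left_mono)
  have C0: "0 \<le> C" using \<eta> by (simp add: C_def)
  have c\<eta>: "1 \<le> c t * \<eta> ^ 3" if "t \<le> T" for t
    using that \<eta> \<kappa> by (simp add: c_def)
  define Z where "Z = C * (4 * R ^ 3)"
  have Z: "0 \<le> Z" using C0 R by (simp add: Z_def)
  define C1 where "C1 = Z * \<Lambda> + M * (1 + B + Z) * R"
  define C2 where "C2 = 28 * C * R\<^sup>2 * \<Lambda>\<^sup>2"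
  have C12: "0 \<le> C1" "0 \<le> C2" using Z R M B C0 by (auto simp: C1_def C2_def)
  \<comment> \<open>A sum, so that \<open>A \<tau> < 1\<close> gives the three smallness conditions on \<open>\<tau>\<close> at once.\<close>
  define A where "A = 2 * \<kappa> + 2 * C1 / \<delta> + 4 * C2 * T / \<delta> + 1"
  have A: "2 * \<kappa> \<le> A" "2 * C1 / \<delta> \<le> A" "4 * C2 * T / \<delta> \<le> A" "0 < A"
    using \<kappa> C12 \<delta> s0 unfolding A_def by (auto intro!: add_nonneg_nonneg add_nonneg_pos)
  obtain N :: nat where N: "A * T < real N" using reals_Archimedean2 by blast
  have N0: "0 < N" using N A(4) s0 by (metis less_trans mult_pos_pos of_nat_0_less_iff order_le_less_trans)
  define \<tau> where "\<tau> = (T - s0) / real N"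
  have \<tau>: "0 < \<tau>" "real N * \<tau> = T - s0" using N0 s0 by (auto simp: \<tau>_def)
  have A\<tau>: "A * \<tau> < 1"
  proof -
    have "A * (T - s0) \<le> A * T" using A s0 by (intro mult_left_mono) auto
    then have "A * (T - s0) < real N" using N by linarith
    then show ?thesis using N0 by (simp add: \<tau>_def)
  qed
  have \<tau>1: "2 * \<kappa> * \<tau> \<le> 1"
    using mult_right_mono[OF A(1), of \<tau>] A\<tau> \<tau> by linarith
  have \<tau>2: "C1 * \<tau> < \<delta> / 2"
  proof -
    have "2 * C1 / \<delta> * \<tau> < 1" using mult_right_mono[OF A(2), of \<tau>] A\<tau> \<tau> by linarith
    then show ?thesis using \<delta> by (simp add: field_simps)
  qed
  have \<tau>3: "C2 * \<tau> * T \<le> \<delta> / 4"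
  proof -
    have "4 * C2 * T / \<delta> * \<tau> < 1" using mult_right_mono[OF A(3), of \<tau>] A\<tau> \<tau> by linarith
    then show ?thesis using \<delta> by (simp add: field_simps)
  qed
  define err where "err = M * (1 + B) * \<eta> * \<tau> + C2 * \<tau>\<^sup>2"
  have err0: "0 \<le> err" using M B \<eta> \<tau> C12 by (simp add: err_def)
  have err: "real i * err \<le> \<delta> / 2" if "i \<le> N" for i
  proof -
    have "real i * err \<le> real N * err" using that err0 by (intro mult_right_mono) auto
    also have "\<dots> = (real N * \<tau>) * (M * (1 + B) * \<eta> + C2 * \<tau>)"
      by (simp add: err_def algebra_simps power2_eq_square)
    also have "\<dots> \<le> T * (M * (1 + B) * \<eta> + C2 * \<tau>)"
      using \<tau> s0 M B \<eta> C12 by (intro mult_right_mono) auto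
    also have "\<dots> \<le> \<delta> / 4 + \<delta> / 4" using \<eta>1 \<tau>3 by (simp add: algebra_simps)
    finally show ?thesis by simp
  qed
  define t where "t i = s0 + real i * \<tau>" for i
  have tT: "t i < T" if "i < N" for i
  proof -
    have "real i * \<tau> < real N * \<tau>"
      using that \<tau>(1) by (intro mult_strict_right_mono) auto
    then show ?thesis using \<tau>(2) by (simp add: t_def)
  qed
  have tN: "t N = T" using \<tau>(2) by (simp add: t_def)
  have ts0: "s0 \<le> t i" for i using \<tau> by (simp add: t_def)
  have tS: "t (Suc i) = t i + \<tau>" for i by (simp add: t_def algebra_simps)

  \<comment> \<open>The invariant at the grid times. The initial path \<open>x0\<close> itself need not be admissible,
    as it may jump after \<open>s0\<close>; hence admissibility of \<open>x\<close> and \<open>x'\<close> is claimed from the first step on.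
    Before \<open>T\<close> their admissible continuations belong to \<open>X\<close> in any case.\<close>
  have "\<exists>x x' y y'. x \<in> \<Omega> T \<and> x' \<in> \<Omega> T \<and>
      (i < N \<longrightarrow> \<X> T L (t i) x \<subseteq> X \<and> \<X> T L (t i) x' \<subseteq> X) \<and> (0 < i \<longrightarrow> x \<in> X \<and> x' \<in> X) \<and>
      y \<le> u (t i) x \<and> v (t i) x' \<le> y' \<and>
      \<delta> - real i * err \<le> y - y' - c (t i) * path_gauge (\<lambda>s. x s - x' s) (t i)" if "i \<le> N" for i
    using that
  proof (induction i)
    case 0
    have "running_sup (\<lambda>s. x0 s - x0 s) s0 = 0" using s0 by (simp add: running_sup_def)
    then have "path_gauge (\<lambda>s. x0 s - x0 s) s0 = 0" by (simp add: path_gauge_def)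
    then show ?case
      using x0 by (intro exI[of _ x0] exI[of _ "u s0 x0"] exI[of _ "v s0 x0"]) (auto simp: t_def X_def \<delta>_def)
  next
    case (Suc i)
    define a b where "a = t i" and "b = t (Suc i)"
    have i: "i < N" using Suc.prems by simp
    have ab: "s0 \<le> a" "a < T" "b = a + \<tau>" "a \<le> b" "b \<le> T"
    proof -
      have "t (Suc i) \<le> T" using tT[of "Suc i"] tN Suc.prems by (cases "Suc i = N") auto
      then show "s0 \<le> a" "a < T" "b = a + \<tau>" "a \<le> b" "b \<le> T"
        using ts0[of i] tT[OF i] tS[of i] \<tau>(1) by (simp_all add: a_def b_def)
    qed
    have a0: "0 \<le> a" using ab s0 by simp
    obtain x x' ya ya' where x: "x \<in> \<Omega> T" "x' \<in> \<Omega> T" "\<X> T L a x \<subseteq> X" "\<X> T L a x' \<subseteq> X"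
      and ya: "ya \<le> u a x" "v a x' \<le> ya'"
      and gap: "\<delta> - real i * err \<le> ya - ya' - c a * path_gauge (\<lambda>s. x s - x' s) a"
      using Suc i unfolding a_def by auto
    define z where "z = c a *\<^sub>R path_gauge_grad (\<lambda>s. x s - x' s) a"
    have aT: "a \<in> {0..<T}" using a0 ab(2) by simp
    have "\<exists>(p, y)\<in>\<Y> T H L a x ya z. \<forall>s\<in>{a..T}. y s \<le> u s p"
      using u aT x(1) ya(1) unfolding minimax_subsolution_def by blast
    then obtain p y where p: "(p, y) \<in> \<Y> T H L a x ya z" "\<And>s. s \<in> {a..T} \<Longrightarrow> y s \<le> u s p"
      by blast
    have "\<exists>(p', y')\<in>\<Y> T H L a x' ya' z. \<forall>s\<in>{a..T}. y' s \<ge> v s p'"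
      using v aT x(2) ya(2) unfolding minimax_supersolution_def by blast
    then obtain p' y' where p': "(p', y') \<in> \<Y> T H L a x' ya' z" "\<And>s. s \<in> {a..T} \<Longrightarrow> v s p' \<le> y' s"
      by blast
    have pX: "p \<in> \<X> T L a x" "p' \<in> \<X> T L a x'" using p p' by (auto simp: Y_set_def)
    then have pX0: "p \<in> X" "p' \<in> X" using x by auto
    have eq: "p s - p' s = x s - x' s" if "s \<in> {0..a}" for s using pX that by (simp add: X_set_def)
    have ge: "path_gauge (\<lambda>s. x s - x' s) a = path_gauge (\<lambda>s. p s - p' s) a"
      "path_gauge_grad (\<lambda>s. x s - x' s) a = path_gauge_grad (\<lambda>s. p s - p' s) a"
      using path_gauge_cong[of a "\<lambda>s. x s - x' s" "\<lambda>s. p s - p' s"] a0 eq by auto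
    have nz: "norm z \<le> Z"
    proof -
      have w: "norm (p s - p' s) \<le> R" if "s \<in> {0..a}" for s using wR[OF pX0, of s] that ab by simp
      have "norm (path_gauge_grad (\<lambda>s. p s - p' s) a) \<le> 4 * running_sup (\<lambda>s. p s - p' s) a ^ 3"
        by (rule norm_path_gauge_grad_le[OF a0 w])
      also have "\<dots> \<le> 4 * R ^ 3"
        by (intro mult_left_mono power_mono running_sup_le[OF a0 w] running_sup_nonneg[OF a0 w]) auto
      finally have "c a * norm (path_gauge_grad (\<lambda>s. p s - p' s) a) \<le> C * (4 * R ^ 3)"
        using cC[OF a0] cpos[of a] C0 by (intro mult_mono) auto
      then show ?thesis using cpos[of a] by (simp add: z_def ge Z_def)
    qed
    have big: "\<delta> / 2 \<le> ya - ya'"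
    proof -
      have "0 \<le> path_gauge (\<lambda>s. x s - x' s) a" by (simp add: path_gauge_def)
      then have "0 \<le> c a * path_gauge (\<lambda>s. x s - x' s) a" using cpos[of a] by simp
      then show ?thesis using gap err[of i] i by linarith
    qed
    have "ya - ya' - c a * path_gauge (\<lambda>s. p s - p' s) a -
        (M * (1 + B) * \<eta> * (b - a) + 28 * c a * R\<^sup>2 * \<Lambda>\<^sup>2 * (b - a)\<^sup>2)
      \<le> y b - y' b - c b * path_gauge (\<lambda>s. p s - p' s) b"
    proof (rule Y_set_gauge_step[OF H a0 ab(4,5,2) p(1) p'(1) M(1) _ _ B(1)])
      show "AE s\<in>{a<..<T} in lebesgue. \<bar>H s p q z - H s p' q z\<bar>
          \<le> M * (1 + \<bar>q\<bar> + norm z) * running_sup (\<lambda>s. p s - p' s) s" for q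
        using M(2)[OF pX0, of q z] by eventually_elim (use ab in auto)
      show "\<bar>y' s\<bar> \<le> B" if "s \<in> {a..b}" "y' s \<le> y s" for s
        using p(2)[of s] p'(2)[of s] B(2)[OF _ pX0(1), of s] B(3)[OF _ pX0(2), of s] that ab by auto
      show "norm (p s - p' s) \<le> R" if "s \<in> {0..b}" for s using wR[OF pX0, of s] that ab by simp
      show "norm ((p s - p' s) - (p a - p' a)) \<le> \<Lambda> * (s - a)" if "s \<in> {a..b}" for s
        using that ab by (intro w\<Lambda> pX0) auto
      show "(norm z * \<Lambda> + M * (1 + B + norm z) * R) * (b - a) < ya - ya'"
      proof -
        have "norm z * \<Lambda> + M * (1 + B + norm z) * R \<le> C1"
          unfolding C1_def using nz R M(1) B(1) Z by (intro add_mono mult_mono mult_left_mono) auto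
        then have "(norm z * \<Lambda> + M * (1 + B + norm z) * R) * (b - a) \<le> C1 * \<tau>"
          using ab \<tau> by (intro mult_mono) (auto simp: C12)
        then show ?thesis using \<tau>2 big by linarith
      qed
      show "z = c a *\<^sub>R path_gauge_grad (\<lambda>s. p s - p' s) a" by (simp add: z_def ge)
      show "1 \<le> c a * \<eta> ^ 3" using ab by (intro c\<eta>) auto
      show "2 * M * (5 + B) * c a * (b - a) \<le> c a - c b"
      proof -
        have "c b = c a * exp (- (2 * \<kappa> * \<tau>))"
          unfolding c_def ab(3) by (simp add: exp_add[symmetric] algebra_simps)
        also have "\<dots> \<le> c a * (1 - 2 * \<kappa> * \<tau> / 2)"
          using \<tau>1 \<kappa> \<tau> cpos[of a] by (intro mult_left_mono exp_minus_le_one_minus_half) auto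
        finally have "\<kappa> * c a * \<tau> \<le> c a - c b" by (simp add: algebra_simps)
        then show ?thesis using ab(3) by (simp add: \<kappa>_def)
      qed
    qed (use R \<eta> cpos[of a] in auto)
    moreover have "M * (1 + B) * \<eta> * (b - a) + 28 * c a * R\<^sup>2 * \<Lambda>\<^sup>2 * (b - a)\<^sup>2 \<le> err"
      unfolding err_def C2_def using ab(3) cC[OF a0] by (simp add: mult_right_mono)
    ultimately have "\<delta> - real (Suc i) * err \<le> y b - y' b - c b * path_gauge (\<lambda>s. p s - p' s) b"
      using gap unfolding ge by (simp add: algebra_simps)
    moreover have "\<X> T L b p \<subseteq> X \<and> \<X> T L b p' \<subseteq> X" if "Suc i < N"
    proof -
      have "b < T" "s0 \<le> b" using tT[OF that] ab by (auto simp: b_def)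
      then show ?thesis
        using X_set_concat[OF L s0(1) _ _ pX0(1)[unfolded X_def]]
          X_set_concat[OF L s0(1) _ _ pX0(2)[unfolded X_def]] unfolding X_def by blast
    qed
    moreover have "y b \<le> u b p" "v b p' \<le> y' b" using p(2)[of b] p'(2)[of b] ab by auto
    ultimately show ?case
      unfolding b_def[symmetric] using pX0 X\<Omega>[OF pX0(1)] X\<Omega>[OF pX0(2)]
      by (intro exI[of _ p] exI[of _ p'] exI[of _ "y b"] exI[of _ "y' b"]) simp
  qed
  from this[of N] N0 tN obtain x x' y y' where x: "x \<in> X" "x' \<in> X" and y: "y \<le> u T x" "v T x' \<le> y'"
    and gap: "\<delta> - real N * err \<le> y - y' - c T * path_gauge (\<lambda>s. x s - x' s) T"
    by auto
  \<comment> \<open>At time \<open>T\<close> the gap is bounded, so the gauge, divided by \<open>\<eta>\<close> to the power \<open>3\<close>, is bounded as well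
    and the paths are close, although the gap between their terminal costs is at least \<open>\<delta> / 2\<close>.\<close>
  define m where "m = running_sup (\<lambda>s. x s - x' s) T"
  have gap': "\<delta> / 2 \<le> y - y' - c T * path_gauge (\<lambda>s. x s - x' s) T" using gap err[of N] by linarith
  have "path_gauge (\<lambda>s. x s - x' s) T \<ge> 0" by (simp add: path_gauge_def)
  then have cp: "0 \<le> c T * path_gauge (\<lambda>s. x s - x' s) T" using cpos[of T] by simp
  have "c T = 1 / \<eta> ^ 3" by (simp add: c_def)
  moreover have "y - y' \<le> 2 * B" using y B(2)[OF _ x(1), of T] B(3)[OF _ x(2), of T] s0 by auto
  ultimately have "path_gauge (\<lambda>s. x s - x' s) T / \<eta> ^ 3 \<le> 2 * B" using gap' \<delta> by simp
  then have "path_gauge (\<lambda>s. x s - x' s) T \<le> 2 * B * \<eta> ^ 3" using \<eta>(1) by (simp add: field_simps)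
  then have m4: "m ^ 4 < r ^ 4"
    using path_gauge_ge[of "\<lambda>s. x s - x' s" T] \<eta>2 unfolding m_def by (simp add: field_simps)
  have "m < r" by (rule power_less_imp_less_base[OF m4]) (use r in simp)
  then have "sup_dist T x x' < r" by (simp add: m_def sup_dist_def running_sup_def)
  then have "\<bar>h x - h x'\<bar> < \<delta> / 2" by (rule r(2)[OF x])
  moreover have "u T x \<le> h x" using u X\<Omega>[OF x(1)] by (simp add: minimax_subsolution_def)
  moreover have "h x' \<le> v T x'" using v X\<Omega>[OF x(2)] by (simp add: minimax_supersolution_def)
  ultimately show False using gap' cp y by linarith
qed

theorem corollary5p4:
  fixes T L :: real
    and h :: "(real \<Rightarrow> real^'d) \<Rightarrow> real"
    and H :: "real \<Rightarrow> (real \<Rightarrow> real^'d) \<Rightarrow> real \<Rightarrow> real^'d \<Rightarrow> real"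
    and u v :: "real \<Rightarrow> (real \<Rightarrow> real^'d) \<Rightarrow> real"
  assumes "T > 0"
    and "continuous_terminal_cost T h"
    and "hamiltonian T H"
    and "L \<ge> 0"
    and "minimax_subsolution T H h L u"
    and "minimax_supersolution T H h L v"
  shows "\<forall>t\<in>{0..T}. \<forall>x\<in>\<Omega> T. u t x \<le> v t x"
proof (intro ballI)
  fix t :: real and x :: "real \<Rightarrow> real^'d"
  assume t: "t \<in> {0..T}" and x: "x \<in> \<Omega> T"
  show "u t x \<le> v t x"
  proof (cases "t = T")
    case True
    have "u T x \<le> h x" "h x \<le> v T x"
      using assms(5,6) x by (auto simp: minimax_subsolution_def minimax_supersolution_def)
    then show ?thesis using True by simp
  next
    case False
    then show ?thesis
      using t by (intro minimax_comparison_before_T[OF assms(2-6) _ _ x]) auto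
  qed
qed

end
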